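(* Let $K$ be a field, $S=K[x_1,\ldots,x_n]$, and let $I\subsetneq J\subset S$ be two monomial complete intersection ideals, where $J$ is generated by a regular sequence of $q$ monomials and $I$ is generated by a regular sequence of $p$ monomials. Then $$n-p\;\geq\;\operatorname{sdepth}_S(J/I)\;\geq\; n-p-\left\lfloor\frac{q-p}{2}\right\rfloor.$$
   Context: A monomial complete intersection ideal of $S$ is an ideal generated by monomials forming a regular sequence on $S$; the number of generators refers to the length of this regular sequence (equivalently, the number of minimal monomial generators), and $p=0$ (that is, $I=0$) is allowed. Let $S=K[x_1,\ldots,x_n]$ with its standard $\mathbb Z^n$-grading and let $M\neq 0$ be a $\mathbb Z^n$-graded $S$-module. A Stanley decomposition of $M$ is a finite direct sum decomposition $\mathcal D: M=\bigoplus_{i=1}^r m_iK[Z_i]$ as a $\mathbb Z^n$-graded $K$-vector space, where each $m_i\in M$ is homogeneous with respect to the $\mathbb Z^n$-grading, $Z_i\subset\{x_1,\ldots,x_n\}$, and $m_iK[Z_i]=\{um_i: u\in K[Z_i]\}\subset M$ is a free $K[Z_i]$-submodule of $M$. Put $\operatorname{sdepth}(\mathcal D)=\min_{i}|Z_i|$ and $\operatorname{sdepth}_S(M)=\max\{\operatorname{sdepth}(\mathcal D): \mathcal D \text{ is a Stanley decomposition of } M\}$; this is the Stanley depth of $M$. *)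

theory Defs
  imports
    Complex_Main
    "HOL-Library.Cardinality"
    "HOL-Library.Poly_Mapping"
    "HOL-Algebra.Ideal"
    "HOL-Algebra.QuotRing"
    "HOL-Algebra.Module"
    "HOL-Decision_Procs.Algebra_Aux"
begin

section \<open>The polynomial ring and its multigrading\<close>

text \<open>
  The variables are indexed by a finite type \<open>'n\<close>, so the number of variables is
  \<open>CARD('n)\<close>. An exponent vector is a \<open>'n \<Rightarrow>\<^sub>0 nat\<close> and a polynomial is a finitely supported
  function from exponent vectors to coefficients, with the convolution product of
  \<^theory>\<open>HOL-Library.Poly_Mapping\<close>.
\<close>

type_synonym ('n, 'k) mpoly = "('n \<Rightarrow>\<^sub>0 nat) \<Rightarrow>\<^sub>0 'k"

abbreviation mpoly_ring :: "('n::finite, 'k::field) mpoly ring" where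
  "mpoly_ring \<equiv> cring_class_ops"

definition is_monomial :: "('n::finite, 'k::field) mpoly \<Rightarrow> bool" where
  "is_monomial f \<longleftrightarrow> (\<exists>u. f = Poly_Mapping.single u 1)"

text \<open>The homogeneous component of \<open>S\<close> of degree \<open>a \<in> \<int>\<^sup>n\<close>; it is zero unless \<open>a \<ge> 0\<close>.\<close>

definition mpoly_component :: "('n::finite \<Rightarrow> int) \<Rightarrow> ('n, 'k::field) mpoly set" where
  "mpoly_component a = {f. \<forall>u\<in>Poly_Mapping.keys f. \<forall>i. int (Poly_Mapping.lookup u i) = a i}"

text \<open>The subalgebra \<open>K[Z]\<close> of \<open>S\<close>, for a set \<open>Z\<close> of variables.\<close>

definition mpoly_in_vars :: "'n set \<Rightarrow> ('n::finite, 'k::field) mpoly set" where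
  "mpoly_in_vars Z = {f. \<forall>u\<in>Poly_Mapping.keys f. Poly_Mapping.keys u \<subseteq> Z}"


section \<open>Complete intersection monomial ideals\<close>

text \<open>A regular sequence on a commutative ring \<open>R\<close>, with the usual requirement that the
  sequence generates a proper ideal.\<close>

definition regular_sequence :: "('a, 'b) ring_scheme \<Rightarrow> 'a list \<Rightarrow> bool" where
  "regular_sequence R fs \<longleftrightarrow>
     set fs \<subseteq> carrier R \<and>
     (\<forall>i<length fs. \<forall>g\<in>carrier R.
        fs ! i \<otimes>\<^bsub>R\<^esub> g \<in> genideal R (set (take i fs)) \<longrightarrow> g \<in> genideal R (set (take i fs))) \<and>
     genideal R (set fs) \<noteq> carrier R"

text \<open>For \<open>p = 0\<close> the sequence is empty and \<open>I = 0\<close>.\<close>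

definition monomial_complete_intersection ::
    "nat \<Rightarrow> ('n::finite, 'k::field) mpoly set \<Rightarrow> bool" where
  "monomial_complete_intersection p I \<longleftrightarrow>
     (\<exists>fs. length fs = p \<and> (\<forall>f\<in>set fs. is_monomial f) \<and>
           regular_sequence mpoly_ring fs \<and> I = genideal mpoly_ring (set fs))"


section \<open>Multigraded modules and Stanley depth\<close>

text \<open>A \<open>\<int>\<^sup>n\<close>-graded \<open>S\<close>-module: \<open>Gr a\<close> is the homogeneous component of degree \<open>a\<close>.
  The components are \<open>K\<close>-subspaces because constants have degree zero.\<close>

definition multigraded_module ::
    "(('n::finite, 'k::field) mpoly, 'm) module \<Rightarrow> (('n \<Rightarrow> int) \<Rightarrow> 'm set) \<Rightarrow> bool" where
  "multigraded_module M Gr \<longleftrightarrow>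
     module mpoly_ring M \<and>
     (\<forall>a. subgroup (Gr a) (add_monoid M)) \<and>
     (\<forall>a b. \<forall>f\<in>mpoly_component b. \<forall>x\<in>Gr a. f \<odot>\<^bsub>M\<^esub> x \<in> Gr (\<lambda>i. b i + a i)) \<and>
     (\<forall>x\<in>carrier M. \<exists>!v. (\<forall>a. v a \<in> Gr a) \<and> finite {a. v a \<noteq> \<zero>\<^bsub>M\<^esub>} \<and>
        x = (\<Oplus>\<^bsub>M\<^esub>a\<in>{a. v a \<noteq> \<zero>\<^bsub>M\<^esub>}. v a))"

definition stanley_space ::
    "(('n::finite, 'k::field) mpoly, 'm) module \<Rightarrow> 'm \<Rightarrow> 'n set \<Rightarrow> 'm set" where
  "stanley_space M m Z = (\<lambda>f. f \<odot>\<^bsub>M\<^esub> m) ` mpoly_in_vars Z"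

text \<open>The entries \<open>(m, Z)\<close> of the list are the summands \<open>m K[Z]\<close>. As \<open>m K[Z]\<close> is generated by
  \<open>m\<close>, its being a free \<open>K[Z]\<close>-module (with basis \<open>m\<close>) means that \<open>m\<close> has zero annihilator in
  \<open>K[Z]\<close>. Since every \<open>m\<close> is homogeneous, the summands are graded subspaces, and the sum is
  direct as graded vector spaces as soon as it is direct.\<close>

definition stanley_decomposition ::
    "(('n::finite, 'k::field) mpoly, 'm) module \<Rightarrow> (('n \<Rightarrow> int) \<Rightarrow> 'm set) \<Rightarrow>
     ('m \<times> 'n set) list \<Rightarrow> bool" where
  "stanley_decomposition M Gr D \<longleftrightarrow>
     (\<forall>(m, Z)\<in>set D.
        m \<in> carrier M \<and> (\<exists>a. m \<in> Gr a) \<and>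
        (\<forall>f\<in>mpoly_in_vars Z. f \<odot>\<^bsub>M\<^esub> m = \<zero>\<^bsub>M\<^esub> \<longrightarrow> f = 0)) \<and>
     (\<forall>x\<in>carrier M. \<exists>!v.
        v \<in> (\<Pi>\<^sub>E i\<in>{..<length D}. stanley_space M (fst (D ! i)) (snd (D ! i))) \<and>
        x = (\<Oplus>\<^bsub>M\<^esub>i\<in>{..<length D}. v i))"

definition sdepth_of_decomposition :: "('m \<times> 'n::finite set) list \<Rightarrow> nat" where
  "sdepth_of_decomposition D = Min ((\<lambda>(m, Z). card Z) ` set D)"

text \<open>For \<open>M \<noteq> 0\<close> every decomposition is a nonempty list, so the maximum ranges over a set of
  numbers bounded by \<open>CARD('n)\<close>.\<close>

definition sdepth ::
    "(('n::finite, 'k::field) mpoly, 'm) module \<Rightarrow> (('n \<Rightarrow> int) \<Rightarrow> 'm set) \<Rightarrow> nat" where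
  "sdepth M Gr = Max (sdepth_of_decomposition ` {D. stanley_decomposition M Gr D})"


section \<open>The multigraded module \<open>J/I\<close>\<close>

text \<open>\<open>J/I\<close> is the submodule of \<open>S/I\<close> consisting of the cosets of elements of \<open>J\<close>. The
  fields \<open>mult\<close> and \<open>one\<close> of the record play no role for modules.\<close>

definition quotient_module :: "('a, 'b) ring_scheme \<Rightarrow> 'a set \<Rightarrow> 'a set \<Rightarrow> ('a, 'a set) module" where
  "quotient_module R J I =
     \<lparr>carrier = (\<lambda>x. I +>\<^bsub>R\<^esub> x) ` J,
      mult = (\<otimes>\<^bsub>R Quot I\<^esub>), one = \<one>\<^bsub>R Quot I\<^esub>, zero = \<zero>\<^bsub>R Quot I\<^esub>, add = (\<oplus>\<^bsub>R Quot I\<^esub>),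
      smult = (\<lambda>r X. (I +>\<^bsub>R\<^esub> r) \<otimes>\<^bsub>R Quot I\<^esub> X)\<rparr>"

definition quotient_grading ::
    "('n::finite, 'k::field) mpoly set \<Rightarrow> ('n, 'k) mpoly set \<Rightarrow>
     ('n \<Rightarrow> int) \<Rightarrow> ('n, 'k) mpoly set set" where
  "quotient_grading J I a = (\<lambda>x. I +>\<^bsub>mpoly_ring\<^esub> x) ` (J \<inter> mpoly_component a)"

definition sdepth_quotient ::
    "('n::finite, 'k::field) mpoly set \<Rightarrow> ('n, 'k) mpoly set \<Rightarrow> nat" where
  "sdepth_quotient J I = sdepth (quotient_module mpoly_ring J I) (quotient_grading J I)"


subsection \<open>\<open>J/I\<close> is a multigraded module\<close>

lemma mpoly_coset_eq_iff:
  fixes I :: "('n::finite, 'k::field) mpoly set"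
  assumes "ideal I mpoly_ring"
  shows "I +>\<^bsub>mpoly_ring\<^esub> x = I +>\<^bsub>mpoly_ring\<^esub> y \<longleftrightarrow> x - y \<in> I"
  using ring.quotient_eq_iff_same_a_r_cos[OF cring.axioms(1)[OF cring_class] assms, of x y]
  by (simp add: class_simps)

lemma ideal_classD:
  fixes I :: "'a::comm_ring_1 set"
  assumes "ideal I cring_class_ops"
  shows "0 \<in> I" and "x \<in> I \<Longrightarrow> y \<in> I \<Longrightarrow> x + y \<in> I" and "x \<in> I \<Longrightarrow> y * x \<in> I"
    and "x \<in> I \<Longrightarrow> - x \<in> I" and "x \<in> I \<Longrightarrow> y \<in> I \<Longrightarrow> x - y \<in> I"
proof -
  interpret ideal I cring_class_ops by fact
  show "0 \<in> I" using zero_closed by (simp add: class_simps)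
  show p: "x \<in> I \<Longrightarrow> y \<in> I \<Longrightarrow> x + y \<in> I" for x y
    using a_closed[of x y] by (simp add: class_simps)
  show m: "x \<in> I \<Longrightarrow> y * x \<in> I" for x y
    using I_l_closed[of x y] by (simp add: class_simps)
  show u: "x \<in> I \<Longrightarrow> - x \<in> I" for x using m[of x "-1"] by simp
  show "x \<in> I \<Longrightarrow> y \<in> I \<Longrightarrow> x - y \<in> I" using p[of x "- y"] u[of y] by simp
qed

lemma ideal_classI:
  fixes I :: "'a::comm_ring_1 set"
  assumes "0 \<in> I" and "\<And>x y. x \<in> I \<Longrightarrow> y \<in> I \<Longrightarrow> x + y \<in> I"
    and "\<And>x y. x \<in> I \<Longrightarrow> y * x \<in> I"
  shows "ideal I cring_class_ops"
proof (rule idealI[OF cring.axioms(1)[OF cring_class]])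
  have u: "x \<in> I \<Longrightarrow> - x \<in> I" for x using assms(3)[of x "-1"] by simp
  show "subgroup I (add_monoid (cring_class_ops :: 'a ring))"
  proof (rule group.subgroupI)
    show "group (add_monoid (cring_class_ops :: 'a ring))"
      by (rule abelian_group.a_group[OF ring.is_abelian_group[OF cring.axioms(1)[OF cring_class]]])
  next
    fix a assume "a \<in> I"
    then show "inv\<^bsub>add_monoid cring_class_ops\<^esub> a \<in> I"
      using u by (metis a_inv_def uminus_class)
  qed (use assms(1,2) in \<open>auto simp: cring_class_ops_def\<close>)
qed (use assms(3) in \<open>auto simp: class_simps mult.commute\<close>)

lemma monomial_complete_intersection_ideal:
  assumes "monomial_complete_intersection p I"
  shows "ideal I mpoly_ring"
  using assms ring.genideal_ideal[OF cring.axioms(1)[OF cring_class]]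
  by (auto simp: monomial_complete_intersection_def regular_sequence_def)

lemma monomial_times_keys:
  fixes g :: "('n::finite, 'k::field) mpoly"
  assumes "w \<in> Poly_Mapping.keys (y * g)"
  obtains u v where "u \<in> Poly_Mapping.keys g" "w = v + u"
  using keys_mult[of y g] assms by auto

lemma monomial_ideal_single:
  fixes I :: "('n::finite, 'k::field) mpoly set"
  assumes "monomial_complete_intersection p I" and "f \<in> I"
  shows "Poly_Mapping.single u (Poly_Mapping.lookup f u) \<in> I"
proof -
  from assms(1) obtain fs where fs: "\<forall>f\<in>set fs. is_monomial f"
    and I: "I = genideal mpoly_ring (set fs)"
    by (auto simp: monomial_complete_intersection_def)
  have id: "ideal I mpoly_ring" by (rule monomial_complete_intersection_ideal) fact
  define L where
    "L = {f :: ('n, 'k) mpoly. \<forall>u\<in>Poly_Mapping.keys f. Poly_Mapping.single u 1 \<in> I}"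
  have "ideal L mpoly_ring"
  proof (rule ideal_classI)
    show "0 \<in> L" by (simp add: L_def)
    show "x + y \<in> L" if "x \<in> L" "y \<in> L" for x y
      using that Poly_Mapping.keys_add[of x y] by (auto simp: L_def)
    show "y * x \<in> L" if "x \<in> L" for x y
    proof -
      have "Poly_Mapping.single w 1 \<in> I" if w: "w \<in> Poly_Mapping.keys (y * x)" for w
      proof -
        obtain u v where u: "u \<in> Poly_Mapping.keys x" and w: "w = v + u"
          using monomial_times_keys[OF w] .
        have "Poly_Mapping.single v 1 * Poly_Mapping.single u 1 \<in> I"
          using \<open>x \<in> L\<close> u by (intro ideal_classD(3)[OF id]) (auto simp: L_def)
        then show ?thesis by (simp add: w mult_single)
      qed
      then show ?thesis by (auto simp: L_def)
    qed
  qed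
  moreover have "set fs \<subseteq> L"
  proof
    fix f assume f: "f \<in> set fs"
    moreover have "f \<in> I"
      unfolding I using ring.genideal_self[OF cring.axioms(1)[OF cring_class], of "set fs"] f
        carrier_class by blast
    ultimately show "f \<in> L" using fs by (fastforce simp: L_def is_monomial_def)
  qed
  ultimately have "I \<subseteq> L"
    unfolding I by (rule ring.genideal_minimal[OF cring.axioms(1)[OF cring_class]])
  then have L: "f \<in> L" using assms(2) by auto
  show ?thesis
  proof (cases "u \<in> Poly_Mapping.keys f")
    case True
    then have "Poly_Mapping.single 0 (Poly_Mapping.lookup f u) * Poly_Mapping.single u 1 \<in> I"
      using L by (intro ideal_classD(3)[OF id]) (auto simp: L_def)
    then show ?thesis by (simp add: mult_single)
  next
    case False
    then show ?thesis using ideal_classD(1)[OF id] by (simp add: in_keys_iff)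
  qed
qed

definition multidegree :: "('n \<Rightarrow>\<^sub>0 nat) \<Rightarrow> 'n \<Rightarrow> int" where
  "multidegree u = (\<lambda>i. int (Poly_Mapping.lookup u i))"

lemma inj_multidegree: "inj multidegree"
  by (intro injI poly_mapping_eqI) (auto simp: multidegree_def dest: fun_cong)

definition component_of :: "('n \<Rightarrow> int) \<Rightarrow> ('n::finite, 'k::field) mpoly \<Rightarrow> ('n, 'k) mpoly" where
  "component_of a f = (if a \<in> range multidegree
     then Poly_Mapping.single (inv_into UNIV multidegree a) (Poly_Mapping.lookup f (inv_into UNIV multidegree a)) else 0)"

lemma component_of_multidegree [simp]:
  "component_of (multidegree u) f = Poly_Mapping.single u (Poly_Mapping.lookup f u)"
  by (simp add: component_of_def inj_multidegree inv_f_f)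

lemma mem_mpoly_component:
  "f \<in> mpoly_component a \<longleftrightarrow> (\<forall>u\<in>Poly_Mapping.keys f. multidegree u = a)"
  by (auto simp: mpoly_component_def multidegree_def)

lemma component_of_mem: "component_of a f \<in> mpoly_component a"
  by (auto simp: component_of_def mem_mpoly_component f_inv_into_f split: if_splits)

lemma component_of_diff: "component_of a (f - g) = component_of a f - component_of a g"
  by (simp add: component_of_def lookup_minus single_diff)

lemma component_of_add: "component_of a (f + g) = component_of a f + component_of a g"
  by (simp add: component_of_def lookup_add single_add)

lemma component_of_sum: "component_of a (sum g A) = (\<Sum>b\<in>A. component_of a (g b))"
proof (induction A rule: infinite_finite_induct)
  case (insert b A)
  then show ?case by (simp add: component_of_add)
qed (simp_all add: component_of_def)

lemma component_of_homogeneous: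
  assumes "g \<in> mpoly_component b"
  shows "component_of a g = (if a = b then g else 0)"
proof (cases "a \<in> range multidegree")
  case True
  then obtain u where a: "a = multidegree u" by auto
  have *: "w = u" if "w \<in> Poly_Mapping.keys g" "multidegree u = b" for w
    using assms that by (auto simp: mem_mpoly_component inj_eq[OF inj_multidegree])
  show ?thesis
  proof (cases "a = b")
    case True
    then show ?thesis using * a
      by (auto intro!: poly_mapping_eqI simp: lookup_single when_def) (metis in_keys_iff)
  next
    case False
    then have "u \<notin> Poly_Mapping.keys g" using assms a by (auto simp: mem_mpoly_component)
    then show ?thesis using False a by (simp add: in_keys_iff)
  qed
next
  case False
  have "g = 0" if "a = b"
  proof (rule ccontr)
    assume "g \<noteq> 0"
    then obtain w where "w \<in> Poly_Mapping.keys g" by (metis equals0I keys_eq_empty)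
    then show False using False assms that by (auto simp: mem_mpoly_component)
  qed
  then show ?thesis using False by (simp add: component_of_def)
qed

lemma sum_component_of: "(\<Sum>a\<in>multidegree ` Poly_Mapping.keys f. component_of a f) = f"
proof -
  have "(\<Sum>a\<in>multidegree ` Poly_Mapping.keys f. component_of a f)
      = (\<Sum>u\<in>Poly_Mapping.keys f. Poly_Mapping.single u (Poly_Mapping.lookup f u))"
    by (subst sum.reindex) (auto intro: inj_on_subset[OF inj_multidegree])
  also have "\<dots> = f"
    by (rule poly_mapping_eqI) (auto simp: lookup_sum lookup_single when_def in_keys_iff)
  finally show ?thesis .
qed

lemma component_of_ideal:
  assumes "monomial_complete_intersection p I" and "f \<in> I"
  shows "component_of a f \<in> I"
  using monomial_ideal_single[OF assms]
    ideal_classD(1)[OF monomial_complete_intersection_ideal[OF assms(1)]]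
  by (auto simp: component_of_def)

lemma multigraded_module_quotient:
  fixes I J :: "('n::finite, 'k::field) mpoly set"
  assumes "monomial_complete_intersection p I" and "monomial_complete_intersection q J"
    and "I \<subseteq> J"
  shows "multigraded_module (quotient_module mpoly_ring J I) (quotient_grading J I)"
proof -
  let ?R = "mpoly_ring :: ('n, 'k) mpoly ring"
  define M where "M = quotient_module ?R J I"
  define c where "c = (\<lambda>x. I +>\<^bsub>?R\<^esub> x)"
  have I: "ideal I ?R" and J: "ideal J ?R"
    using assms by (auto intro: monomial_complete_intersection_ideal)
  note ID = ideal_classD[OF I] and JD = ideal_classD[OF J]
  have eq: "c x = c y \<longleftrightarrow> x - y \<in> I" for x y
    unfolding c_def by (rule mpoly_coset_eq_iff[OF I])
  have c0: "c 0 = I"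
    using abelian_group.a_coset_add_zero[of ?R I, OF _ subsetI[OF carrier_class]]
      ring.is_abelian_group[OF cring.axioms(1)[OF cring_class]]
    by (simp add: c_def class_simps)
  have carrier: "carrier M = c ` J" by (simp add: M_def quotient_module_def c_def)
  have zero: "\<zero>\<^bsub>M\<^esub> = c 0" by (simp add: M_def quotient_module_def FactRing_def c0)
  have add: "c x \<oplus>\<^bsub>M\<^esub> c y = c (x + y)" for x y
    using abelian_subgroup.a_rcos_sum[OF ideal.axioms(1)[OF I, THEN abelian_subgroupI3], of x y]
      ring.is_abelian_group[OF cring.axioms(1)[OF cring_class]]
    by (simp add: M_def quotient_module_def FactRing_def c_def class_simps)
  have smult: "f \<odot>\<^bsub>M\<^esub> c x = c (f * x)" for f x
    using ideal.rcoset_mult_add[OF I, of f x]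
    by (simp add: M_def quotient_module_def FactRing_def c_def class_simps)
  have grading: "quotient_grading J I a = c ` (J \<inter> mpoly_component a)" for a
    by (simp add: quotient_grading_def c_def)
  have group: "abelian_group M"
  proof (rule abelian_groupI)
    fix x assume "x \<in> carrier M"
    then obtain f where f: "f \<in> J" "x = c f" by (auto simp: carrier)
    then show "\<exists>y\<in>carrier M. y \<oplus>\<^bsub>M\<^esub> x = \<zero>\<^bsub>M\<^esub>"
      by (intro bexI[of _ "c (- f)"]) (auto simp: carrier add zero JD(4))
  qed (auto simp: carrier add zero JD intro!: imageI simp: add_ac)
  have mod: "module ?R M"
    by (rule moduleI[OF cring_class group])
       (auto simp: carrier add smult class_simps JD algebra_simps)
  interpret M: module ?R M by fact
  have uminus: "\<ominus>\<^bsub>M\<^esub> c f = c (- f)" if "f \<in> J" for f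
    using that by (intro M.minus_equality) (auto simp: carrier add zero JD(4))
  have finsum: "(\<Oplus>\<^bsub>M\<^esub>a\<in>A. c (g a)) = c (sum g A)" if "finite A" "\<And>a. a \<in> A \<Longrightarrow> g a \<in> J"
    for A :: "('n \<Rightarrow> int) set" and g
    using that
  proof (induction A rule: finite_induct)
    case (insert a A)
    then show ?case by (subst M.finsum_insert) (auto simp: carrier add)
  qed (simp add: zero)
  have subgr: "subgroup (quotient_grading J I a) (add_monoid M)" for a
  proof (rule group.subgroupI[OF M.a_group])
    show "quotient_grading J I a \<noteq> {}"
      using JD(1) by (auto simp: grading mpoly_component_def intro!: exI[of _ 0])
    show "inv\<^bsub>add_monoid M\<^esub> x \<in> quotient_grading J I a" if x: "x \<in> quotient_grading J I a" for x
    proof -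
      obtain f where f: "f \<in> J" "f \<in> mpoly_component a" "x = c f" using x by (auto simp: grading)
      then have "- f \<in> J \<inter> mpoly_component a" by (auto simp: JD(4) mem_mpoly_component in_keys_iff)
      then show ?thesis using uminus[OF f(1)] by (auto simp: f(3) grading a_inv_def[symmetric])
    qed
    show "x \<otimes>\<^bsub>add_monoid M\<^esub> y \<in> quotient_grading J I a"
      if x: "x \<in> quotient_grading J I a" and y: "y \<in> quotient_grading J I a" for x y
    proof -
      obtain f g where f: "f \<in> J" "f \<in> mpoly_component a" "x = c f"
        and g: "g \<in> J" "g \<in> mpoly_component a" "y = c g" using x y by (auto simp: grading)
      then have "f + g \<in> J \<inter> mpoly_component a"
        using Poly_Mapping.keys_add[of f g] by (auto simp: JD(2) mem_mpoly_component)
      then show ?thesis by (auto simp: f(3) g(3) grading add)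
    qed
  qed (auto simp: grading carrier)
  have act: "f \<odot>\<^bsub>M\<^esub> x \<in> quotient_grading J I (\<lambda>i. b i + a i)"
    if f: "f \<in> mpoly_component b" and x: "x \<in> quotient_grading J I a" for f x a b
  proof -
    obtain g where g: "g \<in> J" "g \<in> mpoly_component a" "x = c g" using x by (auto simp: grading)
    have "f * g \<in> mpoly_component (\<lambda>i. b i + a i)"
      using keys_mult[of f g] f g(2) by (fastforce simp: mpoly_component_def lookup_add)
    then show ?thesis using g by (auto simp: grading smult JD(3))
  qed
  have dir: "\<exists>!v. (\<forall>a. v a \<in> quotient_grading J I a) \<and> finite {a. v a \<noteq> \<zero>\<^bsub>M\<^esub>} \<and>
      x = (\<Oplus>\<^bsub>M\<^esub>a\<in>{a. v a \<noteq> \<zero>\<^bsub>M\<^esub>}. v a)" if x: "x \<in> carrier M" for x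
  proof -
    obtain f where f: "f \<in> J" "x = c f" using x by (auto simp: carrier)
    have fJ: "component_of a f \<in> J" for a by (rule component_of_ideal[OF assms(2) f(1)])
    define w where "w = (\<lambda>a. c (component_of a f))"
    define B where "B = multidegree ` Poly_Mapping.keys f"
    have wI: "w a \<in> quotient_grading J I a" for a
      using fJ component_of_mem by (auto simp: w_def grading)
    have sub: "{a. w a \<noteq> \<zero>\<^bsub>M\<^esub>} \<subseteq> B"
    proof
      fix a assume "a \<in> {a. w a \<noteq> \<zero>\<^bsub>M\<^esub>}"
      then have nz: "component_of a f \<noteq> 0" by (auto simp: w_def zero)
      then obtain u where a: "a = multidegree u" by (auto simp: component_of_def split: if_splits)
      then show "a \<in> B" using nz unfolding B_def a by (intro imageI) (auto simp: in_keys_iff)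
    qed
    have finB: "finite B" by (simp add: B_def)
    have fin: "finite {a. w a \<noteq> \<zero>\<^bsub>M\<^esub>}" using sub finB by (rule finite_subset)
    have "(\<Oplus>\<^bsub>M\<^esub>a\<in>{a. w a \<noteq> \<zero>\<^bsub>M\<^esub>}. w a) = (\<Oplus>\<^bsub>M\<^esub>a\<in>B. w a)"
      using sub finB fJ by (intro M.add.finprod_mono_neutral_cong_left) (auto simp: w_def carrier)
    also have "\<dots> = x"
      unfolding w_def using fJ finB by (subst finsum) (auto simp: f(2) B_def sum_component_of)
    finally have sum: "x = (\<Oplus>\<^bsub>M\<^esub>a\<in>{a. w a \<noteq> \<zero>\<^bsub>M\<^esub>}. w a)" ..
    show ?thesis
    proof (rule ex1I[of _ w])
      show "(\<forall>a. w a \<in> quotient_grading J I a) \<and> finite {a. w a \<noteq> \<zero>\<^bsub>M\<^esub>} \<and>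
        x = (\<Oplus>\<^bsub>M\<^esub>a\<in>{a. w a \<noteq> \<zero>\<^bsub>M\<^esub>}. w a)" using wI fin sum by blast
    next
      fix v assume v: "(\<forall>a. v a \<in> quotient_grading J I a) \<and> finite {a. v a \<noteq> \<zero>\<^bsub>M\<^esub>} \<and>
        x = (\<Oplus>\<^bsub>M\<^esub>a\<in>{a. v a \<noteq> \<zero>\<^bsub>M\<^esub>}. v a)"
      define A where "A = {a. v a \<noteq> \<zero>\<^bsub>M\<^esub>}"
      have "\<forall>a. \<exists>g. g \<in> J \<and> g \<in> mpoly_component a \<and> v a = c g" using v by (auto simp: grading)
      then obtain g where g: "\<And>a. g a \<in> J" "\<And>a. g a \<in> mpoly_component a" "\<And>a. v a = c (g a)"
        by metis
      have finA: "finite A" using v by (simp add: A_def)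
      have "c f = (\<Oplus>\<^bsub>M\<^esub>a\<in>A. c (g a))" using v f(2) g(3) by (simp add: A_def)
      also have "\<dots> = c (sum g A)" using finA g(1) by (rule finsum)
      finally have fg: "f - sum g A \<in> I" by (simp add: eq)
      have comp: "component_of b f - (if b \<in> A then g b else 0) \<in> I" for b
      proof -
        have "component_of b (sum g A) = (\<Sum>a\<in>A. if b = a then g a else 0)"
          unfolding component_of_sum using component_of_homogeneous[OF g(2)] by (intro sum.cong) auto
        also have "\<dots> = (if b \<in> A then g b else 0)" using finA by simp
        finally show ?thesis using component_of_ideal[OF assms(1) fg, of b]
          by (simp add: component_of_diff)
      qed
      show "v = w"
      proof
        fix b
        show "v b = w b"
        proof (cases "b \<in> A")
          case True
          then show ?thesis using comp[of b] g(3)[of b] by (simp add: w_def) (metis eq)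
        next
          case False
          then have "v b = c 0" by (simp add: A_def zero)
          moreover have "w b = c 0" using comp[of b] False by (simp add: w_def eq)
          ultimately show ?thesis by simp
        qed
      qed
    qed
  qed
  show ?thesis
    unfolding multigraded_module_def M_def[symmetric] using mod subgr act dir by blast
qed

end

theory Submission
  imports Defs "HOL-Library.Disjoint_Sets"
begin

text \<open>
  Let \<open>u\<^sub>j\<close> and \<open>v\<^sub>i\<close> be the monomial generators of \<open>J\<close> and \<open>I\<close>. A regular sequence of monomials
  consists of monomials with nonempty and pairwise disjoint supports.

  Upper bound: if \<open>m K[Z]\<close> is free in \<open>J/I\<close>, then no \<open>v\<^sub>i\<close> lies in \<open>K[Z]\<close>, since \<open>v\<^sub>i m = 0\<close>. So each of
  the \<open>p\<close> disjoint supports contains a variable outside \<open>Z\<close>, and \<open>card Z \<le> n - p\<close>. This already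
  bounds every single summand of a Stanley decomposition (\<open>card_free_variables_le\<close>).

  Lower bound: it suffices to partition the exponents of the monomials in \<open>J\<close> but not in \<open>I\<close> into
  cones \<open>w + \<nat>\<^sup>Z\<close> of dimension at least \<open>n - p - (q - p) div 2\<close>
  (\<open>stanley_decomposition_of_cones\<close>). Imposing that a monomial is divisible by a given one costs no
  dimension, and imposing that it is not divisible costs one. As the \<open>v\<^sub>i\<close> have disjoint supports,
  they are multiples of distinct generators \<open>u\<^bsub>\<sigma> i\<^esub>\<close> of \<open>J\<close>. Among the monomials of \<open>J\<close> outside \<open>I\<close>,
  those divisible by some \<open>u\<^bsub>\<sigma> i\<^esub>\<close> are cut out, up to a disjoint case distinction, by one
  non-divisibility for each of the \<open>p\<close> indices: by \<open>u\<^bsub>\<sigma> i\<^esub>\<close> or by \<open>v\<^sub>i\<close>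
  (\<open>cone_partitionable_relative\<close>). The others are divisible by no \<open>u\<^bsub>\<sigma> i\<^esub>\<close>, which costs \<open>p\<close>, and by
  at least one of the remaining \<open>m = q - p\<close> generators.

  That last condition must cost only \<open>m div 2\<close>. Sort the monomials by the nonempty set \<open>X\<close> of
  remaining generators that divide them, and partition the nonempty subsets of an \<open>m\<close>-element set
  into intervals \<open>[A, H]\<close>: the condition \<open>A \<subseteq> X \<subseteq> H\<close> costs one dimension for every element outside
  \<open>H\<close>, so all upper ends must miss at most \<open>m div 2\<close> elements. Such a partition is explicit. Place an odd
  number \<open>N\<close> of points on a circle and, for a nonempty set \<open>X\<close> of points, go round the circle and
  include a point into \<open>H\<close> if it lies in \<open>X\<close> or if its predecessor was not included. This has a
  unique consistent solution \<open>H\<close>, and no solution when \<open>X\<close> is empty because \<open>N\<close> is odd. The sets \<open>X\<close>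
  that lead to a given \<open>H\<close> are exactly those between \<open>H\<close> and the set of points of \<open>H\<close> whose
  predecessor lies in \<open>H\<close>. Since \<open>H\<close> never misses two neighbours, it misses at most \<open>N div 2\<close>
  points. For even \<open>m\<close> one additional point, never in \<open>X\<close>, makes the number of points odd and leaves
  the bound unchanged.
\<close>

section \<open>Partitions of sets of exponents into cones\<close>

text \<open>
  Exponent vectors are plain functions here, so that divisibility of monomials is the pointwise
  order; \<open>cone w Z\<close> is the set of exponents of the monomials in \<open>x\<^sup>w K[Z]\<close>.
\<close>

definition cone :: "('n \<Rightarrow> nat) \<Rightarrow> 'n set \<Rightarrow> ('n \<Rightarrow> nat) set" where
  "cone w Z = {v. w \<le> v \<and> (\<forall>i. i \<notin> Z \<longrightarrow> v i = w i)}"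

text \<open>
  Finite disjoint unions of cones of dimension at least \<open>d\<close>. Building the unions in binary steps
  turns the basic closure properties into rule inductions whose only real case is a single cone.
\<close>

inductive cone_partitionable :: "nat \<Rightarrow> ('n \<Rightarrow> nat) set \<Rightarrow> bool" for d where
  empty: "cone_partitionable d {}"
| cone: "d \<le> card Z \<Longrightarrow> cone_partitionable d (cone w Z)"
| disjoint_union: "cone_partitionable d E \<Longrightarrow> cone_partitionable d F \<Longrightarrow> E \<inter> F = {} \<Longrightarrow>
    cone_partitionable d (E \<union> F)"

lemma cone_partitionable_mono:
  "cone_partitionable d E \<Longrightarrow> d' \<le> d \<Longrightarrow> cone_partitionable d' E"
  by (induction rule: cone_partitionable.induct) (auto intro: cone_partitionable.intros)

lemma cone_partitionable_Union:
  assumes "finite A" and "\<And>a. a \<in> A \<Longrightarrow> cone_partitionable d (E a)"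
    and "disjoint_family_on E A"
  shows "cone_partitionable d (\<Union>a\<in>A. E a)"
  using assms
proof (induction A rule: finite_induct)
  case (insert a A)
  then have "E a \<inter> (\<Union>b\<in>A. E b) = {}"
    by (auto simp: disjoint_family_on_def)
  moreover have "disjoint_family_on E A"
    using insert.prems(2) by (rule disjoint_family_on_mono[rotated]) auto
  ultimately show ?case
    using insert by (auto intro!: cone_partitionable.disjoint_union)
qed (simp add: cone_partitionable.empty)

lemma cone_partitionable_UNIV: "cone_partitionable CARD('n) (UNIV :: ('n::finite \<Rightarrow> nat) set)"
proof -
  have "cone (\<lambda>_. 0) (UNIV :: 'n set) = UNIV" by (auto simp: cone_def le_fun_def)
  then show ?thesis
    using cone_partitionable.cone[of "CARD('n)" "UNIV :: 'n set" "\<lambda>_. 0"] by simp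
qed

text \<open>
  The multiples of \<open>t\<close> in a cone \<open>w + \<nat>\<^sup>Z\<close> form a cone with the same free variables and the vertex
  \<open>lcm(w, t)\<close>, or there are none, because \<open>t\<close> exceeds \<open>w\<close> in a variable that is not free.
\<close>

lemma cone_partitionable_multiples:
  "cone_partitionable d E \<Longrightarrow> cone_partitionable d {v \<in> E. t \<le> v}"
proof (induction rule: cone_partitionable.induct)
  case (cone Z w)
  have "{v \<in> cone w Z. t \<le> v} = (if \<forall>i. i \<notin> Z \<longrightarrow> t i \<le> w i then cone (sup t w) Z else {})"
    by (auto simp: cone_def le_fun_def sup_nat_def max.absorb1) metis+
  then show ?case using cone by (auto intro: cone_partitionable.intros)
next
  case (disjoint_union E F)
  have "{v \<in> E \<union> F. t \<le> v} = {v \<in> E. t \<le> v} \<union> {v \<in> F. t \<le> v}" by auto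
  then show ?case using disjoint_union by (auto intro!: cone_partitionable.disjoint_union)
qed (auto intro: cone_partitionable.intros)

lemma cone_partitionable_slice:
  "cone_partitionable d E \<Longrightarrow> cone_partitionable (d - 1) {v \<in> E. v j = b}"
proof (induction rule: cone_partitionable.induct)
  case (cone Z w)
  have "{v \<in> cone w Z. v j = b} =
      (if b = w j \<or> j \<in> Z \<and> w j \<le> b then cone (w(j := b)) (Z - {j}) else {})"
    by (auto simp: cone_def le_fun_def)
  moreover have "d - 1 \<le> card (Z - {j})" using cone by (auto simp: card_Diff_singleton_if)
  ultimately show ?case by (auto intro: cone_partitionable.intros)
next
  case (disjoint_union E F)
  have "{v \<in> E \<union> F. v j = b} = {v \<in> E. v j = b} \<union> {v \<in> F. v j = b}" by auto
  then show ?case using disjoint_union by (auto intro!: cone_partitionable.disjoint_union)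
qed (auto intro: cone_partitionable.intros)

lemma cone_partitionable_below:
  assumes "cone_partitionable d E"
  shows "cone_partitionable (d - 1) {v \<in> E. v j < b}"
proof -
  have "{v \<in> E. v j < b} = (\<Union>c<b. {v \<in> E. v j = c})" by auto
  also have "cone_partitionable (d - 1) \<dots>"
    using assms
    by (intro cone_partitionable_Union cone_partitionable_slice) (auto simp: disjoint_family_on_def)
  finally show ?thesis .
qed

text \<open>
  Classify the vectors \<open>v\<close> with \<open>\<not> t \<le> v\<close> by the first coordinate, in some order, in which \<open>v\<close> is
  smaller than \<open>t\<close>. The earlier coordinates give a divisibility condition, which is free, and this
  coordinate has finitely many possible values, each of which fixes one variable. Thus one
  dimension is lost, no matter how many variables \<open>t\<close> involves.
\<close>

lemma cone_partitionable_non_multiples: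
  fixes t :: "'n::finite \<Rightarrow> nat"
  assumes "cone_partitionable d E"
  shows "cone_partitionable (d - 1) {v \<in> E. \<not> t \<le> v}"
proof -
  have "cone_partitionable (d - 1) {v \<in> E. \<exists>i\<in>V. v i < t i}" if "finite V" for V
    using that
  proof (induction V rule: finite_induct)
    case (insert j V)
    define s where "s = (\<lambda>i. if i \<in> V then t i else 0)"
    have s: "s \<le> v \<longleftrightarrow> (\<forall>i\<in>V. t i \<le> v i)" for v by (auto simp: s_def le_fun_def)
    have "{v \<in> E. \<exists>i\<in>insert j V. v i < t i} =
        {v \<in> E. \<exists>i\<in>V. v i < t i} \<union> {v \<in> {v \<in> E. s \<le> v}. v j < t j}"
      by (auto simp: s not_le[symmetric])
    moreover have "cone_partitionable (d - 1) {v \<in> {v \<in> E. s \<le> v}. v j < t j}"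
      by (intro cone_partitionable_below cone_partitionable_multiples assms)
    ultimately show ?case
      using insert.IH by (auto intro!: cone_partitionable.disjoint_union simp: s not_le[symmetric])
  qed (simp add: cone_partitionable.empty)
  from this[of UNIV] show ?thesis by (simp add: le_fun_def not_le)
qed

lemma cone_partitionable_all_multiples:
  assumes "finite A" and "cone_partitionable d E"
  shows "cone_partitionable d {v \<in> E. \<forall>i\<in>A. t i \<le> v}"
  using assms(1)
proof (induction A rule: finite_induct)
  case (insert j A)
  have "{v \<in> E. \<forall>i\<in>insert j A. t i \<le> v} = {v \<in> {v \<in> E. \<forall>i\<in>A. t i \<le> v}. t j \<le> v}" by auto
  then show ?case using cone_partitionable_multiples[OF insert.IH, of "t j"] by simp
qed (simp add: assms(2))

lemma cone_partitionable_no_multiples: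
  fixes t :: "'a \<Rightarrow> 'n::finite \<Rightarrow> nat"
  assumes "finite A" and "cone_partitionable d E"
  shows "cone_partitionable (d - card A) {v \<in> E. \<forall>i\<in>A. \<not> t i \<le> v}"
  using assms(1)
proof (induction A rule: finite_induct)
  case (insert j A)
  have "{v \<in> E. \<forall>i\<in>insert j A. \<not> t i \<le> v} = {v \<in> {v \<in> E. \<forall>i\<in>A. \<not> t i \<le> v}. \<not> t j \<le> v}"
    by auto
  then show ?case using cone_partitionable_non_multiples[OF insert.IH, of "t j"] insert.hyps by simp
qed (simp add: assms(2))

text \<open>
  Adding an index \<open>j\<close> to \<open>A\<close>, the set splits into two parts: either some earlier \<open>u\<^sub>i\<close> divides \<open>w\<close>, and
  the only new condition is that \<open>v\<^sub>j\<close> does not divide \<open>w\<close>; or no earlier \<open>u\<^sub>i\<close> does, which already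
  implies that no earlier \<open>v\<^sub>i\<close> does, and \<open>u\<^sub>j\<close> divides \<open>w\<close> while \<open>v\<^sub>j\<close> does not. Both parts involve one
  non-divisibility for each index, so the loss is \<open>card A\<close> although there are two
  conditions per index.
\<close>

lemma cone_partitionable_relative:
  fixes u v :: "'a \<Rightarrow> 'n::finite \<Rightarrow> nat"
  assumes "finite A" and "cone_partitionable d E" and "\<And>i. i \<in> A \<Longrightarrow> u i \<le> v i"
  shows "cone_partitionable (d - card A) {w \<in> E. (\<exists>i\<in>A. u i \<le> w) \<and> (\<forall>i\<in>A. \<not> v i \<le> w)}"
  using assms(1,3)
proof (induction A rule: finite_induct)
  case (insert j A)
  define F G where "F = {w \<in> E. (\<exists>i\<in>A. u i \<le> w) \<and> (\<forall>i\<in>A. \<not> v i \<le> w)}"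
    and "G = {w \<in> E. \<forall>i\<in>A. \<not> u i \<le> w}"
  have le: "i \<in> A \<Longrightarrow> v i \<le> w \<Longrightarrow> u i \<le> w" for i w
    using insert.prems by (blast intro: order_trans)
  have "{w \<in> E. (\<exists>i\<in>insert j A. u i \<le> w) \<and> (\<forall>i\<in>insert j A. \<not> v i \<le> w)} =
      {w \<in> F. \<not> v j \<le> w} \<union> {w \<in> {w \<in> G. u j \<le> w}. \<not> v j \<le> w}"
    using le by (auto simp: F_def G_def)
  moreover have "cone_partitionable (d - card A - 1) {w \<in> F. \<not> v j \<le> w}"
    using insert.IH insert.prems unfolding F_def by (intro cone_partitionable_non_multiples) auto
  moreover have "cone_partitionable (d - card A - 1) {w \<in> {w \<in> G. u j \<le> w}. \<not> v j \<le> w}"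
    unfolding G_def using insert.hyps assms(2)
    by (intro cone_partitionable_non_multiples cone_partitionable_multiples
        cone_partitionable_no_multiples)
  ultimately show ?case
    using insert.hyps by (auto intro!: cone_partitionable.disjoint_union simp: F_def G_def)
qed (simp add: cone_partitionable.empty)

section \<open>Partitions of the nonempty subsets of a finite set into intervals\<close>

definition cyclic_pred :: "nat \<Rightarrow> nat \<Rightarrow> nat" where
  "cyclic_pred n z = (if z = 0 then n - 1 else z - 1)"

definition interval_bottom :: "nat \<Rightarrow> nat set \<Rightarrow> nat set" where
  "interval_bottom n H = {z \<in> H. cyclic_pred n z \<in> H}"

text \<open>
  Both ends of an interval are determined by its upper end \<open>H\<close>, so the partition is given by
  the admissible sets \<open>H\<close>: the subsets of the circle that do not miss two neighbouring points.
\<close>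

definition interval_tops :: "nat \<Rightarrow> nat set set" where
  "interval_tops n = {H. H \<subseteq> {..<n} \<and> (\<forall>z<n. z \<in> H \<or> cyclic_pred n z \<in> H)}"

text \<open>
  The condition that \<open>X\<close> lies in the interval with upper end \<open>H\<close> says that \<open>z \<in> H\<close> holds iff \<open>z \<in> X\<close> or
  the predecessor of \<open>z\<close> is not in \<open>H\<close>. The function below solves this recursion along the line
  \<open>0, 1, \<dots>, n - 1\<close>, where \<open>b\<close> is a guess of whether \<open>n - 1\<close>, the predecessor of \<open>0\<close>, lies in \<open>H\<close>. The
  guess is consistent if \<open>b = sweep X b (n - 1)\<close>.
\<close>

primrec sweep :: "nat set \<Rightarrow> bool \<Rightarrow> nat \<Rightarrow> bool" where
  "sweep X b 0 = (0 \<in> X \<or> \<not> b)"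
| "sweep X b (Suc z) = (Suc z \<in> X \<or> \<not> sweep X b z)"

lemma sweep_unique:
  assumes "H \<in> interval_tops n" "interval_bottom n H \<subseteq> X" "X \<subseteq> H" "z < n"
  shows "z \<in> H \<longleftrightarrow> sweep X (n - 1 \<in> H) z"
  using assms(4)
proof (induction z)
  case 0
  then have "0 \<in> H \<or> n - 1 \<in> H" using assms(1) by (fastforce simp: interval_tops_def cyclic_pred_def)
  then show ?case using assms by (auto simp: interval_bottom_def cyclic_pred_def)
next
  case (Suc z)
  then have "Suc z \<in> H \<or> z \<in> H" using assms(1) by (fastforce simp: interval_tops_def cyclic_pred_def)
  then show ?case using assms Suc by (auto simp: interval_bottom_def cyclic_pred_def)
qed

text \<open>
  A point of \<open>X\<close> resets the recursion. Hence for nonempty \<open>X\<close> exactly one guess is consistent.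
\<close>

lemma sweep_start_irrelevant:
  "x \<in> X \<Longrightarrow> x \<le> z \<Longrightarrow> sweep X b z = sweep X b' z"
proof (induction z)
  case (Suc z)
  then show ?case by (cases "x = Suc z") auto
qed auto

text \<open>
  For empty \<open>X\<close> the values alternate, so on an odd circle no guess is consistent.
\<close>

lemma sweep_empty: "sweep {} b z = (b = odd z)"
  by (induction z) auto

lemma interval_tops_partition:
  assumes "odd n" and "X \<subseteq> {..<n}"
  shows "X \<noteq> {} \<longleftrightarrow> (\<exists>H\<in>interval_tops n. interval_bottom n H \<subseteq> X \<and> X \<subseteq> H)"
    (is "_ \<longleftrightarrow> ?R")
proof
  assume "X \<noteq> {}"
  then obtain x where x: "x \<in> X" "x < n" using assms(2) by auto
  \<comment> \<open>Any guess yields the true value at \<open>n - 1\<close>, so a second round starts consistently.\<close>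
  define h where "h = sweep X (sweep X True (n - 1))"
  define H where "H = {z. z < n \<and> h z}"
  have wrap: "h (n - 1) = sweep X True (n - 1)"
    unfolding h_def by (rule sweep_start_irrelevant[OF x(1)]) (use x(2) in auto)
  have h: "h z \<longleftrightarrow> z \<in> X \<or> \<not> h (cyclic_pred n z)" for z
  proof (cases z)
    case 0
    have "h 0 \<longleftrightarrow> 0 \<in> X \<or> \<not> sweep X True (n - 1)" by (simp add: h_def)
    then show ?thesis unfolding wrap[symmetric] using 0 by (simp add: cyclic_pred_def)
  qed (simp add: h_def cyclic_pred_def)
  have pred: "cyclic_pred n z < n" if "z < n" for z using that by (auto simp: cyclic_pred_def)
  have mem: "z \<in> H \<longleftrightarrow> z < n \<and> h z" for z by (simp add: H_def)
  have "H \<in> interval_tops n"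
    unfolding interval_tops_def
  proof (intro CollectI conjI allI impI)
    fix z assume "z < n"
    then show "z \<in> H \<or> cyclic_pred n z \<in> H" using h[of z] pred[of z] mem by blast
  qed (auto simp: mem)
  moreover have "interval_bottom n H \<subseteq> X"
  proof
    fix z assume "z \<in> interval_bottom n H"
    then show "z \<in> X" using h[of z] by (auto simp: interval_bottom_def mem)
  qed
  moreover have "X \<subseteq> H"
  proof
    fix z assume "z \<in> X"
    then show "z \<in> H" using h[of z] assms(2) by (auto simp: mem)
  qed
  ultimately show ?R by blast
next
  assume ?R
  then obtain H where H: "H \<in> interval_tops n" "interval_bottom n H \<subseteq> X" "X \<subseteq> H" by blast
  show "X \<noteq> {}"
  proof
    assume "X = {}"
    with sweep_unique[OF H, of "n - 1"] assms(1) show False by (auto simp: sweep_empty elim: oddE)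
  qed
qed

lemma interval_tops_disjoint:
  assumes "H \<in> interval_tops n" "interval_bottom n H \<subseteq> X" "X \<subseteq> H"
    and "H' \<in> interval_tops n" "interval_bottom n H' \<subseteq> X" "X \<subseteq> H'"
    and "X \<noteq> {}"
  shows "H = H'"
proof -
  note eq = sweep_unique[OF assms(1-3)] sweep_unique[OF assms(4-6)]
  obtain x where x: "x \<in> X" "x < n" using assms(1,3,7) by (auto simp: interval_tops_def)
  have "z \<in> H \<longleftrightarrow> z \<in> H'" if "z < n" for z
  proof -
    have "n - 1 \<in> H \<longleftrightarrow> n - 1 \<in> H'"
      using eq[of "n - 1"] sweep_start_irrelevant[OF x(1), of "n - 1"] x(2)
      by (metis Suc_pred' less_Suc_eq_le not_gr_zero not_less_zero lessI)
    then show ?thesis using eq[OF that] by simp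
  qed
  then show ?thesis using assms(1,4) by (auto simp: interval_tops_def)
qed

text \<open>
  The predecessor map sends the complement of \<open>H\<close> injectively into \<open>H\<close>.
\<close>

lemma card_compl_interval_top:
  assumes "H \<in> interval_tops n"
  shows "card ({..<n} - H) \<le> n div 2"
proof -
  have "inj_on (cyclic_pred n) ({..<n} - H)"
    by (auto simp: inj_on_def cyclic_pred_def split: if_splits)
  moreover have "cyclic_pred n ` ({..<n} - H) \<subseteq> H" using assms by (auto simp: interval_tops_def)
  moreover have fin: "finite H" using assms finite_subset by (auto simp: interval_tops_def)
  ultimately have "card ({..<n} - H) \<le> card H" by (intro card_inj_on_le)
  moreover have "card ({..<n} - H) + card H = n"
    using assms fin by (subst card_Diff_subset) (auto simp: interval_tops_def dest: card_mono[rotated])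
  ultimately show ?thesis by linarith
qed

section \<open>Cone partitions of monomial ideals and their differences\<close>

text \<open>
  Sort the multiples \<open>w\<close> of the \<open>t\<^sub>i\<close> by the interval that contains the set \<open>X w\<close> of all \<open>i\<close> for which \<open>t\<^sub>i\<close>
  divides \<open>w\<close>. An interval with upper end \<open>H\<close> amounts to divisibilities, which are free, and one
  non-divisibility for each of the at most \<open>card S div 2\<close> indices outside \<open>H\<close>.
\<close>

lemma cone_partitionable_some_multiple:
  fixes t :: "'a \<Rightarrow> 'n::finite \<Rightarrow> nat"
  assumes "finite S" and "cone_partitionable d E"
  shows "cone_partitionable (d - card S div 2) {w \<in> E. \<exists>i\<in>S. t i \<le> w}"
proof -
  define m where "m = card S"
  \<comment> \<open>The least odd number not below \<open>m\<close>; its half, rounded down, is still \<open>m div 2\<close>.\<close>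
  define n where "n = 2 * (m div 2) + 1"
  have n: "odd n" "m \<le> n" "n div 2 = m div 2" by (auto simp: n_def)
  obtain f where f: "bij_betw f {..<m} S"
    using ex_bij_betw_nat_finite[OF assms(1)] by (auto simp: m_def atLeast0LessThan)
  define X where "X = (\<lambda>w. {i. i < m \<and> t (f i) \<le> w})"
  have X: "X w \<subseteq> {..<n}" for w using n(2) by (auto simp: X_def)
  have ne: "X w \<noteq> {} \<longleftrightarrow> (\<exists>i\<in>S. t i \<le> w)" for w
    using f by (auto simp: X_def bij_betw_def)
  define P where "P = (\<lambda>H. {w \<in> E. X w \<noteq> {} \<and> interval_bottom n H \<subseteq> X w \<and> X w \<subseteq> H})"
  have "{w \<in> E. \<exists>i\<in>S. t i \<le> w} = (\<Union>H\<in>interval_tops n. P H)"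
    using interval_tops_partition[OF n(1) X] by (auto simp: P_def ne[symmetric])
  also have "cone_partitionable (d - m div 2) \<dots>"
  proof (rule cone_partitionable_Union)
    show "finite (interval_tops n)"
      by (rule finite_subset[of _ "Pow {..<n}"]) (auto simp: interval_tops_def)
    show "disjoint_family_on P (interval_tops n)"
      unfolding disjoint_family_on_def
    proof (intro ballI impI)
      fix H H' assume H: "H \<in> interval_tops n" "H' \<in> interval_tops n" "H \<noteq> H'"
      show "P H \<inter> P H' = {}"
      proof (rule equals0I)
        fix w assume "w \<in> P H \<inter> P H'"
        then show False
          using interval_tops_disjoint[OF H(1) _ _ H(2), of "X w"] H(3) by (simp add: P_def)
      qed
    qed
    fix H assume H: "H \<in> interval_tops n"
    define A N where "A = interval_bottom n H" and "N = {..<m} - H"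
    have "card N \<le> card ({..<n} - H)" using n(2) by (intro card_mono) (auto simp: N_def)
    also have "\<dots> \<le> m div 2" using card_compl_interval_top[OF H] n(3) by simp
    finally have N: "card N \<le> m div 2" .
    have finA: "finite A"
      using H finite_subset[of A "{..<n}"] by (auto simp: A_def interval_bottom_def interval_tops_def)
    show "cone_partitionable (d - m div 2) (P H)"
    proof (cases "A \<subseteq> {..<m}")
      case True
      have "X w \<noteq> {}" if "A \<subseteq> X w" "X w \<subseteq> H" for w
        using interval_tops_partition[OF n(1) X] H that by (auto simp: A_def)
      then have "P H = {w \<in> {w \<in> E. \<forall>i\<in>A. t (f i) \<le> w}. \<forall>i\<in>N. \<not> t (f i) \<le> w}"
        using True by (fastforce simp: P_def A_def[symmetric] N_def X_def)
      also have "cone_partitionable (d - card N) \<dots>"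
        using finA assms(2)
        by (intro cone_partitionable_no_multiples cone_partitionable_all_multiples)
           (auto simp: N_def)
      finally show ?thesis by (rule cone_partitionable_mono) (use N in auto)
    next
      case False
      \<comment> \<open>The lower end contains the additional point, which lies in no \<open>X w\<close>.\<close>
      then have "P H = {}" by (auto simp: P_def A_def X_def)
      then show ?thesis by (simp add: cone_partitionable.empty)
    qed
  qed
  finally show ?thesis by (simp add: m_def)
qed

text \<open>
  The set \<open>F\<close> in the proof collects the monomials divisible by some \<open>u\<^bsub>\<sigma> i\<^esub>\<close>; for them the other
  generators \<open>u\<^sub>j\<close> impose no condition. The set \<open>G\<close> collects those divisible only by generators outside
  the image of \<open>\<sigma>\<close>.
\<close>

lemma cone_partitionable_difference:
  fixes u :: "'b \<Rightarrow> 'n::finite \<Rightarrow> nat" and v :: "'a \<Rightarrow> 'n \<Rightarrow> nat"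
  assumes "finite P" "finite Q" and \<sigma>: "inj_on \<sigma> P" "\<sigma> ` P \<subseteq> Q"
    and dvd: "\<And>i. i \<in> P \<Longrightarrow> u (\<sigma> i) \<le> v i"
  shows "cone_partitionable (CARD('n) - card P - (card Q - card P) div 2)
    ({w. \<exists>j\<in>Q. u j \<le> w} - {w. \<exists>i\<in>P. v i \<le> w})"
proof -
  define F where "F = {w \<in> UNIV. (\<exists>i\<in>P. u (\<sigma> i) \<le> w) \<and> (\<forall>i\<in>P. \<not> v i \<le> w)}"
  define G where "G = {w \<in> {w \<in> UNIV. \<forall>i\<in>P. \<not> u (\<sigma> i) \<le> w}. \<exists>j\<in>Q - \<sigma> ` P. u j \<le> w}"
  have "card (Q - \<sigma> ` P) = card Q - card P"
    using assms by (simp add: card_Diff_subset card_image)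
  moreover have "cone_partitionable (CARD('n) - card P - card (Q - \<sigma> ` P) div 2) G"
    unfolding G_def using assms(1,2)
    by (intro cone_partitionable_some_multiple cone_partitionable_no_multiples
        cone_partitionable_UNIV) auto
  ultimately have "cone_partitionable (CARD('n) - card P - (card Q - card P) div 2) G" by simp
  moreover have "cone_partitionable (CARD('n) - card P - (card Q - card P) div 2) F"
    unfolding F_def using assms(1) dvd
    by (intro cone_partitionable_mono[OF cone_partitionable_relative[OF _ cone_partitionable_UNIV]]) auto
  moreover have "F \<inter> G = {}" by (auto simp: F_def G_def)
  moreover have "{w. \<exists>j\<in>Q. u j \<le> w} - {w. \<exists>i\<in>P. v i \<le> w} = F \<union> G"
  proof -
    have "\<not> v i \<le> w" if "i \<in> P" "\<not> u (\<sigma> i) \<le> w" for i w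
      using dvd[OF that(1)] that(2) by (meson order_trans)
    then show ?thesis using \<sigma>(2) by (fastforce simp: F_def G_def)
  qed
  ultimately show ?thesis by (metis cone_partitionable.disjoint_union)
qed

lemma cone_partitionableE:
  assumes "cone_partitionable d E"
  obtains cs where "distinct cs" and "\<And>w Z. (w, Z) \<in> set cs \<Longrightarrow> d \<le> card Z"
    and "disjoint_family_on (\<lambda>(w, Z). cone w Z) (set cs)"
    and "E = (\<Union>(w, Z)\<in>set cs. cone w Z)"
proof -
  let ?cone = "\<lambda>(w, Z). cone w Z"
  have "\<exists>C. finite C \<and> (\<forall>(w, Z)\<in>C. d \<le> card Z) \<and>
      disjoint_family_on ?cone C \<and> E = \<Union> (?cone ` C)"
    using assms
  proof (induction rule: cone_partitionable.induct)
    case empty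
    show ?case by (intro exI[of _ "{}"]) (auto simp: disjoint_family_on_def)
  next
    case (cone Z w)
    then show ?case by (intro exI[of _ "{(w, Z)}"]) (auto simp: disjoint_family_on_def)
  next
    case (disjoint_union E F)
    then obtain C C' where C: "finite C" "\<forall>(w, Z)\<in>C. d \<le> card Z"
      "disjoint_family_on ?cone C" "E = \<Union> (?cone ` C)"
      and C': "finite C'" "\<forall>(w, Z)\<in>C'. d \<le> card Z"
      "disjoint_family_on ?cone C'" "F = \<Union> (?cone ` C')" by blast
    show ?case
    proof (intro exI[of _ "C \<union> C'"] conjI)
      have "?cone a \<inter> ?cone b = {}" if "a \<in> C" "b \<in> C'" for a b
        using that disjoint_union.hyps(3) C(4) C'(4) by blast
      then show "disjoint_family_on ?cone (C \<union> C')"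
        using C(3) C'(3) unfolding disjoint_family_on_def by (metis Int_commute Un_iff)
    qed (use C C' in auto)
  qed
  then obtain C where "finite C" "\<forall>(w, Z)\<in>C. d \<le> card Z"
    "disjoint_family_on ?cone C" "E = \<Union> (?cone ` C)" by blast
  moreover obtain cs where "set cs = C" "distinct cs"
    using finite_distinct_list[OF \<open>finite C\<close>] by blast
  ultimately show ?thesis by (intro that[of cs]) auto
qed

section \<open>Monomial ideals and regular sequences of monomials\<close>

lemma poly_mapping_sum_single:
  "(\<Sum>u\<in>Poly_Mapping.keys f. Poly_Mapping.single u (Poly_Mapping.lookup f u)) = f"
  by (rule poly_mapping_eqI) (auto simp: lookup_sum lookup_single when_def in_keys_iff)

lemma times_monomial:
  fixes g :: "('n::finite, 'k::field) mpoly"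
  shows "g * Poly_Mapping.single w 1 =
    (\<Sum>u\<in>Poly_Mapping.keys g. Poly_Mapping.single (u + w) (Poly_Mapping.lookup g u))"
  by (subst poly_mapping_sum_single[of g, symmetric]) (simp add: sum_distrib_right mult_single)

lemma lookup_times_monomial:
  fixes g :: "('n::finite, 'k::field) mpoly"
  shows "Poly_Mapping.lookup (g * Poly_Mapping.single w 1) (u + w) = Poly_Mapping.lookup g u"
  unfolding times_monomial by (simp add: lookup_sum lookup_single when_def in_keys_iff)

lemma keys_times_monomial:
  fixes g :: "('n::finite, 'k::field) mpoly"
  shows "Poly_Mapping.keys (g * Poly_Mapping.single w 1) = (\<lambda>u. u + w) ` Poly_Mapping.keys g"
proof
  show "Poly_Mapping.keys (g * Poly_Mapping.single w 1) \<subseteq> (\<lambda>u. u + w) ` Poly_Mapping.keys g"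
    using keys_mult[of g "Poly_Mapping.single w 1"] by auto
  show "(\<lambda>u. u + w) ` Poly_Mapping.keys g \<subseteq> Poly_Mapping.keys (g * Poly_Mapping.single w 1)"
    by (auto simp: in_keys_iff lookup_times_monomial)
qed

lemma times_monomial_eq_0_iff:
  fixes g :: "('n::finite, 'k::field) mpoly"
  shows "g * Poly_Mapping.single w 1 = 0 \<longleftrightarrow> g = 0"
  using keys_times_monomial[of g w] by (metis image_is_empty keys_eq_empty)

lemma exponent_diff_add:
  fixes u w :: "'n \<Rightarrow>\<^sub>0 nat"
  assumes "Poly_Mapping.lookup w \<le> Poly_Mapping.lookup u"
  shows "u - w + w = u"
  using assms by (intro poly_mapping_eqI) (simp add: lookup_add lookup_minus le_fun_def)

text \<open>
  The polynomials all of whose monomials are multiples of generators form an ideal, which gives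
  one direction; the other holds because each term is a multiple of a generator.
\<close>

lemma mem_genideal_monomials_iff:
  fixes f :: "('n::finite, 'k::field) mpoly"
  shows "f \<in> genideal mpoly_ring ((\<lambda>t. Poly_Mapping.single t 1) ` T) \<longleftrightarrow>
    (\<forall>u\<in>Poly_Mapping.keys f. \<exists>t\<in>T. Poly_Mapping.lookup t \<le> Poly_Mapping.lookup u)"
    (is "f \<in> ?I \<longleftrightarrow> ?P f")
proof
  have ring: "ring (mpoly_ring :: ('n, 'k) mpoly ring)" by (rule cring.axioms(1)[OF cring_class])
  have id: "ideal ?I mpoly_ring"
    by (rule ring.genideal_ideal[OF ring]) (simp add: subset_iff carrier_class)
  have "ideal {f. ?P f} mpoly_ring"
  proof (rule ideal_classI)
    fix x y :: "('n, 'k) mpoly"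
    show "y * x \<in> {f. ?P f}" if x: "x \<in> {f. ?P f}"
    proof (intro CollectI ballI)
      fix w assume "w \<in> Poly_Mapping.keys (y * x)"
      then obtain u v where u: "u \<in> Poly_Mapping.keys x" and w: "w = v + u"
        by (rule monomial_times_keys)
      then obtain t where "t \<in> T" "Poly_Mapping.lookup t \<le> Poly_Mapping.lookup u"
        using x by auto
      then show "\<exists>t\<in>T. Poly_Mapping.lookup t \<le> Poly_Mapping.lookup w"
        by (auto simp: w lookup_add le_fun_def intro!: bexI[of _ t] trans_le_add2)
    qed
    show "x + y \<in> {f. ?P f}" if "x \<in> {f. ?P f}" "y \<in> {f. ?P f}"
      using that Poly_Mapping.keys_add[of x y] by blast
  qed simp
  then have "?I \<subseteq> {f. ?P f}" by (rule ring.genideal_minimal[OF ring]) auto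
  then show "f \<in> ?I \<Longrightarrow> ?P f" by auto
  assume P: "?P f"
  have monom: "Poly_Mapping.single u (Poly_Mapping.lookup f u) \<in> ?I" if u: "u \<in> Poly_Mapping.keys f" for u
  proof -
    obtain t where t: "t \<in> T" "Poly_Mapping.lookup t \<le> Poly_Mapping.lookup u" using P u by auto
    have "Poly_Mapping.single t 1 \<in> ?I"
      using ring.genideal_self[OF ring, of "(\<lambda>t. Poly_Mapping.single t 1) ` T"] t(1)
      by (auto simp: carrier_class subset_iff)
    then have "Poly_Mapping.single (u - t) (Poly_Mapping.lookup f u) * Poly_Mapping.single t 1 \<in> ?I"
      by (rule ideal_classD(3)[OF id])
    then show ?thesis by (simp add: mult_single exponent_diff_add[OF t(2)])
  qed
  have "(\<Sum>u\<in>U. Poly_Mapping.single u (Poly_Mapping.lookup f u)) \<in> ?I"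
    if "finite U" "U \<subseteq> Poly_Mapping.keys f" for U
    using that by (induction U rule: finite_induct) (auto intro: ideal_classD(1,2)[OF id] monom)
  from this[of "Poly_Mapping.keys f"] show "f \<in> ?I" by (simp add: poly_mapping_sum_single)
qed

text \<open>
  Suppose that \<open>t\<^sub>i\<close> and \<open>t\<^sub>j\<close> with \<open>i < j\<close> share a variable \<open>x\<close>. Then \<open>t\<^sub>j \<cdot> (t\<^sub>i / x)\<close> is a multiple of \<open>t\<^sub>i\<close>,
  so by regularity of \<open>t\<^sub>j\<close> some earlier \<open>t\<^sub>l\<close> divides \<open>t\<^sub>i / x\<close>. By induction the monomials before \<open>t\<^sub>j\<close> have
  disjoint nonempty supports, which forces \<open>l = i\<close>; but \<open>t\<^sub>i\<close> does not divide \<open>t\<^sub>i / x\<close>.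
\<close>

lemma monomial_regular_sequence_disjoint:
  fixes t :: "nat \<Rightarrow> 'n::finite \<Rightarrow>\<^sub>0 nat"
  assumes reg: "regular_sequence (mpoly_ring :: ('n, 'k::field) mpoly ring)
      (map (\<lambda>i. Poly_Mapping.single (t i) 1) [0..<p])"
  shows "i < p \<Longrightarrow> t i \<noteq> 0"
    and "i < j \<Longrightarrow> j < p \<Longrightarrow> Poly_Mapping.keys (t i) \<inter> Poly_Mapping.keys (t j) = {}"
proof -
  let ?R = "mpoly_ring :: ('n, 'k) mpoly ring"
  let ?x = "\<lambda>u. Poly_Mapping.single u 1 :: ('n, 'k) mpoly"
  let ?dvd = "\<lambda>u v. Poly_Mapping.lookup u \<le> Poly_Mapping.lookup v"
  have take: "set (take j (map (\<lambda>i. ?x (t i)) [0..<p])) = ?x ` t ` {..<j}" if "j \<le> p" for j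
    using that by (auto simp: take_map)
  \<comment> \<open>regularity of the \<open>j\<close>-th monomial, in terms of exponents\<close>
  have step: "\<exists>i<j. ?dvd (t i) v" if j: "j < p" and i: "i < j" "?dvd (t i) (t j + v)" for i j v
  proof -
    have "?x (t j) * ?x v \<in> genideal ?R (?x ` t ` {..<j})"
      unfolding mem_genideal_monomials_iff using i by (auto simp: mult_single)
    moreover have "\<forall>g\<in>carrier ?R. map (\<lambda>i. ?x (t i)) [0..<p] ! j \<otimes>\<^bsub>?R\<^esub> g
        \<in> genideal ?R (?x ` t ` {..<j}) \<longrightarrow> g \<in> genideal ?R (?x ` t ` {..<j})"
      using reg j unfolding regular_sequence_def take[OF less_imp_le[OF j], symmetric] by simp
    ultimately have "?x v \<in> genideal ?R (?x ` t ` {..<j})"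
      using j by (simp add: class_simps)
    then show ?thesis unfolding mem_genideal_monomials_iff by auto
  qed
  have proper: "genideal ?R (?x ` t ` {..<p}) \<noteq> carrier ?R"
    using reg unfolding regular_sequence_def take[OF order_refl, symmetric] by simp
  show nz: "t i \<noteq> 0" if "i < p" for i
  proof
    assume "t i = 0"
    then have "f \<in> genideal ?R (?x ` t ` {..<p})" for f
      unfolding mem_genideal_monomials_iff using that by (auto simp: le_fun_def intro!: bexI[of _ i])
    then show False using proper by (auto simp: carrier_class)
  qed
  show "Poly_Mapping.keys (t i) \<inter> Poly_Mapping.keys (t j) = {}" if "i < j" "j < p" for i j
    using that
  proof (induction j arbitrary: i rule: less_induct)
    case (less j)
    have coprime: "l = i" if "l < j" "?dvd (t l) (t i)" for l
    proof (rule ccontr)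
      assume "l \<noteq> i"
      then have "Poly_Mapping.keys (t l) \<inter> Poly_Mapping.keys (t i) = {}"
        using less.IH[of i l] less.IH[of l i] less.prems \<open>l < j\<close> by (cases "l < i") auto
      moreover have "Poly_Mapping.keys (t l) \<subseteq> Poly_Mapping.keys (t i)"
        using \<open>?dvd (t l) (t i)\<close> by (auto simp: in_keys_iff le_fun_def) (metis less_le_trans)
      ultimately show False using nz[of l] \<open>l < j\<close> less.prems by (simp add: inf.absorb1)
    qed
    show ?case
    proof (rule ccontr)
      assume "Poly_Mapping.keys (t i) \<inter> Poly_Mapping.keys (t j) \<noteq> {}"
      then obtain x where x: "Poly_Mapping.lookup (t i) x \<noteq> 0" "Poly_Mapping.lookup (t j) x \<noteq> 0"
        by (auto simp: in_keys_iff)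
      define v where "v = t i - Poly_Mapping.single x 1"
      have v: "Poly_Mapping.lookup v y = Poly_Mapping.lookup (t i) y - (if y = x then 1 else 0)" for y
        by (simp add: v_def lookup_minus lookup_single when_def)
      have "?dvd (t i) (t j + v)"
        using x by (auto simp: le_fun_def lookup_add v)
      then obtain l where l: "l < j" "?dvd (t l) v" using step[OF less.prems(2,1)] by blast
      have "?dvd v (t i)" by (simp add: le_fun_def v)
      then have "l = i" using coprime l by (meson order_trans)
      then have "Poly_Mapping.lookup (t i) x \<le> Poly_Mapping.lookup v x"
        using l(2) by (simp add: le_fun_def)
      then show False using x by (simp add: v)
    qed
  qed
qed

lemma monomial_complete_intersectionE:
  fixes I :: "('n::finite, 'k::field) mpoly set"
  assumes "monomial_complete_intersection p I"
  obtains t :: "nat \<Rightarrow> 'n \<Rightarrow>\<^sub>0 nat"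
  where "\<And>f. f \<in> I \<longleftrightarrow>
      (\<forall>u\<in>Poly_Mapping.keys f. \<exists>i<p. Poly_Mapping.lookup (t i) \<le> Poly_Mapping.lookup u)"
    and "\<And>i. i < p \<Longrightarrow> t i \<noteq> 0"
    and "\<And>i j. i < p \<Longrightarrow> j < p \<Longrightarrow> i \<noteq> j \<Longrightarrow> Poly_Mapping.keys (t i) \<inter> Poly_Mapping.keys (t j) = {}"
proof -
  obtain fs where fs: "length fs = p" "\<forall>f\<in>set fs. is_monomial f"
    and reg: "regular_sequence mpoly_ring fs" and I: "I = genideal mpoly_ring (set fs)"
    using assms by (auto simp: monomial_complete_intersection_def)
  have "\<forall>i. \<exists>u. i < p \<longrightarrow> fs ! i = Poly_Mapping.single u 1"
    using fs by (auto simp: is_monomial_def)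
  then obtain t where t: "\<And>i. i < p \<Longrightarrow> fs ! i = Poly_Mapping.single (t i) 1" by metis
  have eq: "fs = map (\<lambda>i. Poly_Mapping.single (t i) 1) [0..<p]"
    using fs(1) t by (intro nth_equalityI) auto
  then have set: "set fs = (\<lambda>t. Poly_Mapping.single t 1) ` t ` {..<p}"
    by (auto simp: image_image)
  note disj = monomial_regular_sequence_disjoint[OF reg[unfolded eq]]
  show thesis
  proof (rule that[of t])
    show "f \<in> I \<longleftrightarrow>
      (\<forall>u\<in>Poly_Mapping.keys f. \<exists>i<p. Poly_Mapping.lookup (t i) \<le> Poly_Mapping.lookup u)" for f
      unfolding I set mem_genideal_monomials_iff by auto
    show "t i \<noteq> 0" if "i < p" for i using disj(1) that .
    show "Poly_Mapping.keys (t i) \<inter> Poly_Mapping.keys (t j) = {}" if "i < p" "j < p" "i \<noteq> j" for i j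
      using disj(2)[of i j] disj(2)[of j i] that by (cases "i < j") auto
  qed
qed

section \<open>Stanley decompositions of the quotient\<close>

lemma
  fixes I J :: "('n::finite, 'k::field) mpoly set"
  assumes I: "ideal I mpoly_ring"
  shows carrier_quotient_module:
      "carrier (quotient_module mpoly_ring J I) = (\<lambda>x. I +>\<^bsub>mpoly_ring\<^esub> x) ` J"
    and zero_quotient_module: "\<zero>\<^bsub>quotient_module mpoly_ring J I\<^esub> = I +>\<^bsub>mpoly_ring\<^esub> 0"
    and add_quotient_module:
      "(I +>\<^bsub>mpoly_ring\<^esub> x) \<oplus>\<^bsub>quotient_module mpoly_ring J I\<^esub> (I +>\<^bsub>mpoly_ring\<^esub> y) =
       I +>\<^bsub>mpoly_ring\<^esub> (x + y)"
    and smult_quotient_module: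
      "f \<odot>\<^bsub>quotient_module mpoly_ring J I\<^esub> (I +>\<^bsub>mpoly_ring\<^esub> x) = I +>\<^bsub>mpoly_ring\<^esub> (f * x)"
proof -
  have ag: "abelian_group (mpoly_ring :: ('n, 'k) mpoly ring)"
    by (rule ring.is_abelian_group[OF cring.axioms(1)[OF cring_class]])
  show "carrier (quotient_module mpoly_ring J I) = (\<lambda>x. I +>\<^bsub>mpoly_ring\<^esub> x) ` J"
    by (simp add: quotient_module_def)
  show "\<zero>\<^bsub>quotient_module mpoly_ring J I\<^esub> = I +>\<^bsub>mpoly_ring\<^esub> 0"
    using abelian_group.a_coset_add_zero[OF ag subsetI[OF carrier_class], of I]
    by (simp add: quotient_module_def FactRing_def class_simps)
  show "(I +>\<^bsub>mpoly_ring\<^esub> x) \<oplus>\<^bsub>quotient_module mpoly_ring J I\<^esub> (I +>\<^bsub>mpoly_ring\<^esub> y) =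
       I +>\<^bsub>mpoly_ring\<^esub> (x + y)"
    using abelian_subgroup.a_rcos_sum[OF ideal.axioms(1)[OF I, THEN abelian_subgroupI3], of x y] ag
    by (simp add: quotient_module_def FactRing_def class_simps)
  show "f \<odot>\<^bsub>quotient_module mpoly_ring J I\<^esub> (I +>\<^bsub>mpoly_ring\<^esub> x) = I +>\<^bsub>mpoly_ring\<^esub> (f * x)"
    using ideal.rcoset_mult_add[OF I, of f x]
    by (simp add: quotient_module_def FactRing_def class_simps)
qed

lemma finsum_quotient_module:
  fixes I J :: "('n::finite, 'k::field) mpoly set"
  assumes "monomial_complete_intersection p I" and "monomial_complete_intersection q J"
    and "I \<subseteq> J" and "finite A"
    and "\<And>a. a \<in> A \<Longrightarrow> g a \<in> J" and "\<And>a. a \<in> A \<Longrightarrow> v a = I +>\<^bsub>mpoly_ring\<^esub> g a"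
  shows "(\<Oplus>\<^bsub>quotient_module mpoly_ring J I\<^esub>a\<in>A. v a) =
    I +>\<^bsub>mpoly_ring\<^esub> sum g A"
proof -
  note I = monomial_complete_intersection_ideal[OF assms(1)]
  interpret M: module "mpoly_ring :: ('n, 'k) mpoly ring" "quotient_module mpoly_ring J I"
    using multigraded_module_quotient[OF assms(1-3)] by (simp add: multigraded_module_def)
  show ?thesis
    using assms(4-6)
  proof (induction A rule: finite_induct)
    case (insert a A)
    then show ?case
      by (subst M.finsum_insert)
         (auto simp: carrier_quotient_module[OF I] add_quotient_module[OF I])
  qed (simp add: zero_quotient_module[OF I])
qed

text \<open>
  A generator of \<open>I\<close> annihilates \<open>J/I\<close>, so none of them lies in \<open>K[Z]\<close>; choose for each one a
  variable of its support outside \<open>Z\<close>. These \<open>p\<close> variables are distinct as the supports are disjoint.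
\<close>

lemma card_free_variables_le:
  fixes I J :: "('n::finite, 'k::field) mpoly set"
  assumes I: "monomial_complete_intersection p I"
    and m: "m \<in> carrier (quotient_module mpoly_ring J I)"
    and free: "\<And>f. f \<in> mpoly_in_vars Z \<Longrightarrow>
      f \<odot>\<^bsub>quotient_module mpoly_ring J I\<^esub> m = \<zero>\<^bsub>quotient_module mpoly_ring J I\<^esub> \<Longrightarrow> f = 0"
  shows "card Z + p \<le> CARD('n)"
proof -
  note id = monomial_complete_intersection_ideal[OF I]
  obtain t where t: "\<And>f. f \<in> I \<longleftrightarrow>
      (\<forall>u\<in>Poly_Mapping.keys f. \<exists>i<p. Poly_Mapping.lookup (t i) \<le> Poly_Mapping.lookup u)"
    and disj: "\<And>i j. i < p \<Longrightarrow> j < p \<Longrightarrow> i \<noteq> j \<Longrightarrow>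
      Poly_Mapping.keys (t i) \<inter> Poly_Mapping.keys (t j) = {}"
    by (rule monomial_complete_intersectionE[OF I]) blast
  obtain x where x: "m = I +>\<^bsub>mpoly_ring\<^esub> x" using m by (auto simp: carrier_quotient_module[OF id])
  have "\<exists>y. y \<in> Poly_Mapping.keys (t i) \<and> y \<notin> Z" if "i < p" for i
  proof (rule ccontr)
    let ?f = "Poly_Mapping.single (t i) 1 :: ('n, 'k) mpoly"
    assume "\<nexists>y. y \<in> Poly_Mapping.keys (t i) \<and> y \<notin> Z"
    then have "?f \<in> mpoly_in_vars Z" by (auto simp: mpoly_in_vars_def)
    moreover have "?f \<in> I" using that by (auto simp: t)
    then have "?f * x - 0 \<in> I" using ideal_classD(3)[OF id, of ?f x] by (simp add: mult.commute)
    then have "?f \<odot>\<^bsub>quotient_module mpoly_ring J I\<^esub> m = \<zero>\<^bsub>quotient_module mpoly_ring J I\<^esub>"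
      unfolding x smult_quotient_module[OF id] zero_quotient_module[OF id]
      by (simp only: mpoly_coset_eq_iff[OF id])
    ultimately have "?f = 0" by (rule free)
    then show False by (metis keys_single keys_zero insert_not_empty zero_neq_one)
  qed
  then obtain y where y: "\<And>i. i < p \<Longrightarrow> y i \<in> Poly_Mapping.keys (t i) \<and> y i \<notin> Z" by metis
  have "inj_on y {..<p}"
  proof (rule inj_onI)
    fix i j assume "i \<in> {..<p}" "j \<in> {..<p}" "y i = y j"
    then show "i = j" using disj[of i j] y[of i] y[of j] by auto
  qed
  then have "p = card (y ` {..<p})" by (simp add: card_image)
  also have "\<dots> \<le> card (- Z)" using y by (intro card_mono) auto
  also have "\<dots> = CARD('n) - card Z" by (simp add: Compl_eq_Diff_UNIV card_Diff_subset)
  finally have "p \<le> CARD('n) - card Z" .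
  moreover have "card Z \<le> CARD('n)" by (simp add: card_mono)
  ultimately show ?thesis by simp
qed

text \<open>
  Multiplication by \<open>x\<^sup>w\<close> identifies \<open>K[Z]\<close> with the polynomials supported on a cone. In this form the
  summands of a Stanley decomposition into monomial spaces become subspaces of \<open>S\<close> described
  by supports alone.
\<close>

lemma image_times_monomial:
  fixes w :: "'n::finite \<Rightarrow>\<^sub>0 nat"
  shows "(\<lambda>g. g * Poly_Mapping.single w 1) ` (mpoly_in_vars Z :: ('n, 'k::field) mpoly set) =
    {f. Poly_Mapping.lookup ` Poly_Mapping.keys f \<subseteq> cone (Poly_Mapping.lookup w) Z}"
    (is "?L = ?R")
proof
  show "?L \<subseteq> ?R"
  proof
    fix f assume "f \<in> ?L"
    then obtain g :: "('n, 'k) mpoly" where g: "g \<in> mpoly_in_vars Z"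
      and f: "f = g * Poly_Mapping.single w 1" by auto
    have "Poly_Mapping.lookup (u + w) \<in> cone (Poly_Mapping.lookup w) Z"
      if "u \<in> Poly_Mapping.keys g" for u
    proof -
      have "Poly_Mapping.keys u \<subseteq> Z" using g that by (auto simp: mpoly_in_vars_def)
      then show ?thesis by (auto simp: cone_def le_fun_def lookup_add in_keys_iff subset_iff)
    qed
    then show "f \<in> ?R" by (auto simp: f keys_times_monomial)
  qed
  show "?R \<subseteq> ?L"
  proof
    fix f :: "('n, 'k) mpoly" assume f: "f \<in> ?R"
    define g where "g = (\<Sum>u\<in>Poly_Mapping.keys f. Poly_Mapping.single (u - w) (Poly_Mapping.lookup f u))"
    have u: "u - w + w = u" "Poly_Mapping.keys (u - w) \<subseteq> Z" if "u \<in> Poly_Mapping.keys f" for u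
    proof -
      have "Poly_Mapping.lookup u \<in> cone (Poly_Mapping.lookup w) Z" using f that by auto
      then have le: "Poly_Mapping.lookup w \<le> Poly_Mapping.lookup u"
        and "\<And>i. i \<notin> Z \<Longrightarrow> Poly_Mapping.lookup u i = Poly_Mapping.lookup w i"
        by (auto simp: cone_def)
      then show "Poly_Mapping.keys (u - w) \<subseteq> Z" by (force simp: in_keys_iff lookup_minus)
      show "u - w + w = u" by (rule exponent_diff_add[OF le])
    qed
    have "g * Poly_Mapping.single w 1 = (\<Sum>u\<in>Poly_Mapping.keys f. Poly_Mapping.single u (Poly_Mapping.lookup f u))"
      unfolding g_def sum_distrib_right by (intro sum.cong) (auto simp: mult_single u(1))
    then have "f = g * Poly_Mapping.single w 1" by (simp add: poly_mapping_sum_single)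
    moreover have "Poly_Mapping.keys g \<subseteq> (\<lambda>u. u - w) ` Poly_Mapping.keys f"
      unfolding g_def by (rule order_trans[OF keys_sum]) (auto split: if_splits)
    then have "g \<in> mpoly_in_vars Z" using u(2) by (auto simp: mpoly_in_vars_def)
    ultimately show "f \<in> ?L" by auto
  qed
qed

definition restrict_support :: "('n \<Rightarrow> nat) set \<Rightarrow> ('n, 'k::field) mpoly \<Rightarrow> ('n, 'k) mpoly" where
  "restrict_support C f =
    (\<Sum>u\<in>{u \<in> Poly_Mapping.keys f. Poly_Mapping.lookup u \<in> C}. Poly_Mapping.single u (Poly_Mapping.lookup f u))"

lemma lookup_restrict_support:
  "Poly_Mapping.lookup (restrict_support C f) u =
    (if Poly_Mapping.lookup u \<in> C then Poly_Mapping.lookup f u else 0)"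
  by (auto simp: restrict_support_def lookup_sum lookup_single when_def in_keys_iff)

text \<open>
  Let \<open>A\<close> and \<open>B\<close> be the sets of exponents of the monomials in \<open>I\<close> and \<open>J\<close>. The residue classes of the
  monomials in \<open>J\<close> but not in \<open>I\<close> form a basis of \<open>J/I\<close>, and every cone spans a free space
  \<open>x\<^sup>w K[Z]\<close> because it avoids \<open>A\<close>. So the component of the class of \<open>f\<close> in the \<open>i\<close>-th summand is the
  class of the part of \<open>f\<close> supported on the \<open>i\<close>-th cone, and nothing else is possible.
\<close>

lemma stanley_decomposition_of_cones:
  fixes I J :: "('n::finite, 'k::field) mpoly set"
  assumes CI: "monomial_complete_intersection p I" "monomial_complete_intersection q J" "I \<subseteq> J"
    and I: "\<And>f. f \<in> I \<longleftrightarrow> (\<forall>u\<in>Poly_Mapping.keys f. Poly_Mapping.lookup u \<in> A)"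
    and J: "\<And>f. f \<in> J \<longleftrightarrow> (\<forall>u\<in>Poly_Mapping.keys f. Poly_Mapping.lookup u \<in> B)"
    and part: "cone_partitionable d (B - A)"
  shows "\<exists>D. stanley_decomposition (quotient_module mpoly_ring J I) (quotient_grading J I) D \<and>
    (\<forall>(m, Z)\<in>set D. d \<le> card Z)"
proof -
  define M where "M = quotient_module mpoly_ring J I"
  define c where "c = (\<lambda>x. I +>\<^bsub>mpoly_ring\<^esub> x)"
  note id = monomial_complete_intersection_ideal[OF CI(1)]
  have eq: "c x = c y \<longleftrightarrow> x - y \<in> I" for x y
    unfolding c_def by (rule mpoly_coset_eq_iff[OF id])
  have carrier: "carrier M = c ` J" and zero: "\<zero>\<^bsub>M\<^esub> = c 0" and smult: "f \<odot>\<^bsub>M\<^esub> c x = c (f * x)" for f x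
    unfolding M_def c_def
    by (rule carrier_quotient_module[OF id] zero_quotient_module[OF id] smult_quotient_module[OF id])+
  have finsum: "(\<Oplus>\<^bsub>M\<^esub>i\<in>S. v i) = c (sum g S)"
    if "finite S" "\<And>i. i \<in> S \<Longrightarrow> g i \<in> J" "\<And>i. i \<in> S \<Longrightarrow> v i = c (g i)"
    for S :: "nat set" and g v
    unfolding M_def c_def by (rule finsum_quotient_module[OF CI that[unfolded c_def]])

  obtain cs where cs: "distinct cs" "\<And>w Z. (w, Z) \<in> set cs \<Longrightarrow> d \<le> card Z"
    "disjoint_family_on (\<lambda>(w, Z). cone w Z) (set cs)" "B - A = (\<Union>(w, Z)\<in>set cs. cone w Z)"
    using cone_partitionableE[OF part] by blast
  define N where "N = length cs"
  define C where "C = (\<lambda>i. case cs ! i of (w, Z) \<Rightarrow> cone w Z)"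
  have C_unique: "i = j" if "i < N" "j < N" "e \<in> C i" "e \<in> C j" for i j e
  proof (rule ccontr)
    assume "i \<noteq> j"
    then have "cs ! i \<noteq> cs ! j" using that(1,2) cs(1) by (simp add: nth_eq_iff_index_eq N_def)
    then have "C i \<inter> C j = {}"
      using cs(3) that(1,2) unfolding disjoint_family_on_def C_def N_def by (metis nth_mem)
    then show False using that by auto
  qed
  have C_cover: "B - A = (\<Union>i<N. C i)"
  proof -
    have "set cs = (!) cs ` {..<N}" by (auto simp: N_def set_conv_nth)
    then show ?thesis unfolding cs(4) by (simp add: C_def)
  qed
  define expo where "expo = (\<lambda>w::'n \<Rightarrow> nat. Abs_poly_mapping w)"
  have expo [simp]: "Poly_Mapping.lookup (expo w) = w" for w
    by (simp add: expo_def Abs_poly_mapping_inverse)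
  define D where "D = map (\<lambda>(w, Z). (c (Poly_Mapping.single (expo w) 1), Z)) cs"
  have len: "length D = N" by (simp add: D_def N_def)
  have space: "stanley_space M (fst (D ! i)) (snd (D ! i)) =
      c ` {f. Poly_Mapping.lookup ` Poly_Mapping.keys f \<subseteq> C i}" if "i < N" for i
  proof -
    obtain w Z where wZ: "cs ! i = (w, Z)" by fastforce
    then have "D ! i = (c (Poly_Mapping.single (expo w) 1), Z)" using that by (simp add: D_def N_def)
    then have "stanley_space M (fst (D ! i)) (snd (D ! i)) =
        c ` (\<lambda>g. g * Poly_Mapping.single (expo w) 1) ` mpoly_in_vars Z"
      by (simp add: stanley_space_def smult image_image)
    then show ?thesis by (simp add: image_times_monomial C_def wZ)
  qed
  have summand: "m \<in> carrier M \<and> (\<exists>a. m \<in> quotient_grading J I a) \<and>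
      (\<forall>f\<in>mpoly_in_vars Z. f \<odot>\<^bsub>M\<^esub> m = \<zero>\<^bsub>M\<^esub> \<longrightarrow> f = 0)" if mZ: "(m, Z) \<in> set D" for m Z
  proof -
    obtain w where w: "(w, Z) \<in> set cs" and m: "m = c (Poly_Mapping.single (expo w) 1)"
      using mZ by (auto simp: D_def)
    have sub: "cone w Z \<subseteq> B - A" using w cs(4) by auto
    have "w \<in> cone w Z" by (simp add: cone_def)
    then have mJ: "Poly_Mapping.single (expo w) 1 \<in> J" using sub by (auto simp: J)
    moreover have "Poly_Mapping.single (expo w) 1 \<in> mpoly_component (multidegree (expo w))"
      by (simp add: mem_mpoly_component)
    ultimately have "m \<in> quotient_grading J I (multidegree (expo w))"
      unfolding quotient_grading_def m c_def by blast
    moreover have "f = 0" if f: "f \<in> mpoly_in_vars Z" "f \<odot>\<^bsub>M\<^esub> m = \<zero>\<^bsub>M\<^esub>" for f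
    proof -
      let ?g = "f * Poly_Mapping.single (expo w) 1"
      have "?g \<in> I" using f(2) by (simp add: m smult zero eq)
      moreover have "Poly_Mapping.lookup ` Poly_Mapping.keys ?g \<subseteq> cone w Z"
        using image_times_monomial[of "expo w" Z] f(1) by auto
      ultimately have "Poly_Mapping.keys ?g = {}" using sub I[of ?g] by blast
      then show "f = 0" by (simp add: times_monomial_eq_0_iff)
    qed
    ultimately show ?thesis using mJ by (auto simp: carrier m)
  qed
  have direct: "\<exists>!v. v \<in> (\<Pi>\<^sub>E i\<in>{..<length D}. stanley_space M (fst (D ! i)) (snd (D ! i))) \<and>
      x = (\<Oplus>\<^bsub>M\<^esub>i\<in>{..<length D}. v i)" if "x \<in> carrier M" for x
  proof -
    obtain f where f: "f \<in> J" "x = c f" using \<open>x \<in> carrier M\<close> by (auto simp: carrier)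
    define r where "r = (\<lambda>i. restrict_support (C i) f)"
    have r_keys: "Poly_Mapping.lookup ` Poly_Mapping.keys (r i) \<subseteq> C i" for i
      by (auto simp: r_def in_keys_iff lookup_restrict_support split: if_splits)
    have supp_J: "g \<in> J" if "i < N" "Poly_Mapping.lookup ` Poly_Mapping.keys g \<subseteq> C i" for g i
      using that C_cover by (fastforce simp: J)
    have sum_eq: "(\<Sum>j<N. Poly_Mapping.lookup (g j) u) = Poly_Mapping.lookup (g i) u"
      if g: "\<And>j. j < N \<Longrightarrow> Poly_Mapping.lookup ` Poly_Mapping.keys (g j) \<subseteq> C j"
        and i: "i < N" "Poly_Mapping.lookup u \<in> C i" for g i and u :: "'n \<Rightarrow>\<^sub>0 nat"
    proof -
      have "Poly_Mapping.lookup (g j) u = 0" if "j < N" "j \<noteq> i" for j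
        using g[OF that(1)] C_unique[OF that(1) i(1) _ i(2)] that(2)
        by (metis imageI in_keys_iff subsetD)
      then show ?thesis using i(1) by (subst sum.remove[of _ i]) (auto intro!: sum.neutral)
    qed
    have "f - (\<Sum>i<N. r i) \<in> I"
      unfolding I
    proof
      fix u assume u: "u \<in> Poly_Mapping.keys (f - (\<Sum>i<N. r i))"
      have notin: "Poly_Mapping.lookup u \<notin> C i" if "i < N" for i
      proof
        assume "Poly_Mapping.lookup u \<in> C i"
        then have "Poly_Mapping.lookup (f - (\<Sum>i<N. r i)) u = 0"
          using sum_eq[of r i u] r_keys that
          by (simp add: lookup_minus lookup_sum r_def lookup_restrict_support)
        then show False using u by (simp add: in_keys_iff)
      qed
      then have "Poly_Mapping.lookup (f - (\<Sum>i<N. r i)) u = Poly_Mapping.lookup f u"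
        by (simp add: lookup_minus lookup_sum r_def lookup_restrict_support)
      then have "Poly_Mapping.lookup u \<in> B" using u f(1) by (auto simp: J in_keys_iff)
      then show "Poly_Mapping.lookup u \<in> A" using notin C_cover by blast
    qed
    then have x_sum: "x = c (\<Sum>i<N. r i)" by (simp add: f(2) eq)
    show ?thesis
      unfolding len
    proof (rule ex1I[of _ "restrict (\<lambda>i. c (r i)) {..<N}"], intro conjI)
      show "restrict (\<lambda>i. c (r i)) {..<N} \<in> (\<Pi>\<^sub>E i\<in>{..<N}. stanley_space M (fst (D ! i)) (snd (D ! i)))"
        using r_keys by (auto simp: space)
      show "x = (\<Oplus>\<^bsub>M\<^esub>i\<in>{..<N}. restrict (\<lambda>i. c (r i)) {..<N} i)"
        unfolding x_sum using supp_J[OF _ r_keys] by (intro finsum[symmetric]) auto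
    next
      fix v assume v: "v \<in> (\<Pi>\<^sub>E i\<in>{..<N}. stanley_space M (fst (D ! i)) (snd (D ! i))) \<and>
        x = (\<Oplus>\<^bsub>M\<^esub>i\<in>{..<N}. v i)"
      then have "\<forall>i. \<exists>g. i < N \<longrightarrow> Poly_Mapping.lookup ` Poly_Mapping.keys g \<subseteq> C i \<and> v i = c g"
        by (fastforce simp: space PiE_iff)
      then obtain g where g: "\<And>i. i < N \<Longrightarrow> Poly_Mapping.lookup ` Poly_Mapping.keys (g i) \<subseteq> C i"
        and vg: "\<And>i. i < N \<Longrightarrow> v i = c (g i)" by metis
      have "(\<Oplus>\<^bsub>M\<^esub>i\<in>{..<N}. v i) = c (\<Sum>i<N. g i)"
        using supp_J[OF _ g] vg by (intro finsum) auto
      then have "c f = c (\<Sum>i<N. g i)" using v f(2) by simp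
      then have fg: "f - (\<Sum>i<N. g i) \<in> I" by (simp add: eq)
      have "g i = r i" if i: "i < N" for i
      proof (rule poly_mapping_eqI)
        fix u
        show "Poly_Mapping.lookup (g i) u = Poly_Mapping.lookup (r i) u"
        proof (cases "Poly_Mapping.lookup u \<in> C i")
          case True
          then have "Poly_Mapping.lookup u \<notin> A" using C_cover i by blast
          then have "u \<notin> Poly_Mapping.keys (f - (\<Sum>i<N. g i))" using fg by (auto simp: I)
          then show ?thesis using True sum_eq[of g i u] g i
            by (simp add: in_keys_iff lookup_minus lookup_sum r_def lookup_restrict_support)
        next
          case False
          then show ?thesis using g[OF i] r_keys[of i] by (metis image_subset_iff in_keys_iff)
        qed
      qed
      then show "v = restrict (\<lambda>i. c (r i)) {..<N}"
        using v vg by (intro extensionalityI[of _ "{..<N}"]) (auto simp: PiE_def)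
    qed
  qed
  have "stanley_decomposition M (quotient_grading J I) D"
    unfolding stanley_decomposition_def using summand direct by auto
  moreover have "\<forall>(m, Z)\<in>set D. d \<le> card Z" using cs(2) by (auto simp: D_def)
  ultimately show ?thesis unfolding M_def by blast
qed

section \<open>The bounds on the Stanley depth\<close>

theorem theorem2p4:
  fixes I J :: "('n::finite, 'k::field) mpoly set" and p q :: nat
  assumes "monomial_complete_intersection p I"
    and "monomial_complete_intersection q J"
    and "I \<subset> J"
  shows "int CARD('n) - int p \<ge> int (sdepth_quotient J I) \<and>
         int (sdepth_quotient J I) \<ge> int CARD('n) - int p - \<lfloor>(real q - real p) / 2\<rfloor>"
proof -
  let ?M = "quotient_module mpoly_ring J I"
  let ?decomp = "stanley_decomposition ?M (quotient_grading J I)"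
  note id = monomial_complete_intersection_ideal[OF assms(1)]
  \<comment> \<open>The empty sum is zero, but \<open>J/I\<close> is not; so the minimum over the summands is meaningful.\<close>
  have nonempty: "D \<noteq> []" if "?decomp D" for D
  proof
    assume "D = []"
    obtain x where x: "x \<in> J" "x \<notin> I" using assms(3) by auto
    then have "I +>\<^bsub>mpoly_ring\<^esub> x \<in> carrier ?M" by (simp add: carrier_quotient_module[OF id])
    with that \<open>D = []\<close> obtain v where "I +>\<^bsub>mpoly_ring\<^esub> x = (\<Oplus>\<^bsub>?M\<^esub>i\<in>({} :: nat set). v i)"
      unfolding stanley_decomposition_def by auto
    also have "\<dots> = I +>\<^bsub>mpoly_ring\<^esub> (\<Sum>i\<in>({} :: nat set). 0)"
      using assms by (intro finsum_quotient_module) auto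
    finally show False using x(2) mpoly_coset_eq_iff[OF id, of x 0] by simp
  qed
  have upper: "sdepth_of_decomposition D + p \<le> CARD('n)" if "?decomp D" for D
  proof -
    obtain m Z where mZ: "(m, Z) \<in> set D"
      using nonempty[OF \<open>?decomp D\<close>] by (cases D) auto
    have "card Z + p \<le> CARD('n)"
      using that mZ unfolding stanley_decomposition_def
      by (intro card_free_variables_le[OF assms(1), of m J]) auto
    moreover have "sdepth_of_decomposition D \<le> card Z"
      unfolding sdepth_of_decomposition_def using mZ by (intro Min_le) force+
    ultimately show ?thesis by simp
  qed
  obtain v where v: "\<And>f. f \<in> I \<longleftrightarrow>
      (\<forall>e\<in>Poly_Mapping.keys f. \<exists>i<p. Poly_Mapping.lookup (v i) \<le> Poly_Mapping.lookup e)"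
    and disj: "\<And>i j. i < p \<Longrightarrow> j < p \<Longrightarrow> i \<noteq> j \<Longrightarrow>
      Poly_Mapping.keys (v i) \<inter> Poly_Mapping.keys (v j) = {}"
    by (rule monomial_complete_intersectionE[OF assms(1)]) blast
  obtain u where u: "\<And>f. f \<in> J \<longleftrightarrow>
      (\<forall>e\<in>Poly_Mapping.keys f. \<exists>i<q. Poly_Mapping.lookup (u i) \<le> Poly_Mapping.lookup e)"
    and nz: "\<And>i. i < q \<Longrightarrow> u i \<noteq> 0"
    by (rule monomial_complete_intersectionE[OF assms(2)]) blast
  have "\<exists>j<q. Poly_Mapping.lookup (u j) \<le> Poly_Mapping.lookup (v i)" if "i < p" for i
  proof -
    have "Poly_Mapping.single (v i) 1 \<in> I" using that by (auto simp: v)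
    then have "Poly_Mapping.single (v i) 1 \<in> J" using assms(3) by auto
    then show ?thesis by (simp add: u)
  qed
  then obtain \<sigma> where \<sigma>: "\<And>i. i < p \<Longrightarrow> \<sigma> i < q"
    and dvd: "\<And>i. i < p \<Longrightarrow> Poly_Mapping.lookup (u (\<sigma> i)) \<le> Poly_Mapping.lookup (v i)" by metis
  \<comment> \<open>A common divisor of two generators of \<open>I\<close> is \<open>1\<close>, which is not a generator of \<open>J\<close>.\<close>
  have inj: "inj_on \<sigma> {..<p}"
  proof (rule inj_onI, rule ccontr)
    fix i j assume ij: "i \<in> {..<p}" "j \<in> {..<p}" "\<sigma> i = \<sigma> j" "i \<noteq> j"
    obtain y where "Poly_Mapping.lookup (u (\<sigma> i)) y \<noteq> 0"
      using nz[OF \<sigma>] ij(1) by (metis keys_eq_empty equals0I in_keys_iff lessThan_iff)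
    then have "Poly_Mapping.lookup (v i) y \<noteq> 0" "Poly_Mapping.lookup (v j) y \<noteq> 0"
      using dvd[of i] dvd[of j] ij by (auto simp: le_fun_def intro: less_le_trans)
    then show False using disj[of i j] ij by (auto simp: in_keys_iff)
  qed
  have pq: "p \<le> q" using card_inj_on_le[OF inj, of "{..<q}"] \<sigma> by auto
  define d where "d = CARD('n) - p - (q - p) div 2"
  define A B where "A = {e. \<exists>i\<in>{..<p}. Poly_Mapping.lookup (v i) \<le> e}"
    and "B = {e. \<exists>j\<in>{..<q}. Poly_Mapping.lookup (u j) \<le> e}"
  have "cone_partitionable d (B - A)"
    using cone_partitionable_difference[OF _ _ inj, of "{..<q}"
        "\<lambda>j. Poly_Mapping.lookup (u j)" "\<lambda>i. Poly_Mapping.lookup (v i)"] \<sigma> dvd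
    by (auto simp: d_def A_def B_def)
  moreover have "f \<in> I \<longleftrightarrow> (\<forall>e\<in>Poly_Mapping.keys f. Poly_Mapping.lookup e \<in> A)" for f
    unfolding v A_def by blast
  moreover have "f \<in> J \<longleftrightarrow> (\<forall>e\<in>Poly_Mapping.keys f. Poly_Mapping.lookup e \<in> B)" for f
    unfolding u B_def by blast
  ultimately obtain D where D: "?decomp D" "\<forall>(m, Z)\<in>set D. d \<le> card Z"
    using stanley_decomposition_of_cones[OF assms(1,2), of A B d] assms(3) by blast
  have lower: "d \<le> sdepth_of_decomposition D"
    unfolding sdepth_of_decomposition_def using D(2) nonempty[OF D(1)] by (subst Min_ge_iff) auto
  let ?S = "sdepth_of_decomposition ` {D. ?decomp D}"
  have "?S \<subseteq> {..CARD('n)}" using upper by fastforce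
  then have fin: "finite ?S" by (rule finite_subset) simp
  have "sdepth_quotient J I \<in> ?S"
    unfolding sdepth_quotient_def sdepth_def using fin D(1) by (intro Max_in) auto
  then have "sdepth_quotient J I + p \<le> CARD('n)" using upper by auto
  moreover have "sdepth_of_decomposition D \<le> sdepth_quotient J I"
    unfolding sdepth_quotient_def sdepth_def using fin D(1) by (intro Max_ge) auto
  moreover have "\<lfloor>(real q - real p) / 2\<rfloor> = int ((q - p) div 2)"
    using pq floor_divide_of_nat_eq[of "q - p" 2, where ?'a = real] by (simp add: of_nat_diff)
  ultimately show ?thesis using lower by (auto simp: d_def)
qed

end
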